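(* Let $\mathbf H$ be either $\mathbf Z$ or $\mathbf N$, and let $F:\mathbf Z\to\mathbf Z$ be a non-constant polynomial function with integer coefficients. Then the set $X:=\{k\in\mathbf H:F(k)\in\mathbf P\}$ is small, where $\mathbf P$ is the set of positive and negative primes.
   Context: $\mathbf N=\{0,1,2,\dots\}$, $\mathbf N^+=\mathbf N\setminus\{0\}$. For $X\subseteq\mathbf H$, $k\in\mathbf N^+$, $h\in\mathbf N$ write $k\cdot X+h:=\{kx+h:x\in X\}$. An upper quasi-density on $\mathbf H$ is a function $\mu^\ast:\mathcal P(\mathbf H)\to\mathbf R$ such that for all $X,Y\subseteq\mathbf H$, $k\in\mathbf N^+$, $h\in\mathbf N$: $\mu^\ast(X)\le 1$, $\mu^\ast(\mathbf H)=1$, $\mu^\ast(X\cup Y)\le\mu^\ast(X)+\mu^\ast(Y)$, $\mu^\ast(k\cdot X)=\frac1k\mu^\ast(X)$, and $\mu^\ast(X+h)=\mu^\ast(X)$. A set $X\subseteq\mathbf H$ is small if $\mu^\ast(X)=0$ for every upper quasi-density $\mu^\ast$ on $\mathbf H$. *)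

theory Defs
  imports "HOL-Computational_Algebra.Computational_Algebra"
begin

(* Both choices of the ambient set H are represented as sets of integers: UNIV for the integers
   and \<nat> = range of_nat for the natural numbers.  A function on the power set of H is a total
   function on int set; its values outside Pow H are irrelevant. *)

definition upper_quasi_density_on :: "int set \<Rightarrow> (int set \<Rightarrow> real) \<Rightarrow> bool" where
  "upper_quasi_density_on H \<mu> \<longleftrightarrow>
     (\<forall>X\<subseteq>H. \<mu> X \<le> 1) \<and>
     \<mu> H = 1 \<and>
     (\<forall>X\<subseteq>H. \<forall>Y\<subseteq>H. \<mu> (X \<union> Y) \<le> \<mu> X + \<mu> Y) \<and>
     (\<forall>X\<subseteq>H. \<forall>k::nat. k > 0 \<longrightarrow> \<mu> ((\<lambda>x. int k * x) ` X) = 1 / real k * \<mu> X) \<and>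
     (\<forall>X\<subseteq>H. \<forall>h::nat. \<mu> ((\<lambda>x. x + int h) ` X) = \<mu> X)"

definition small_on :: "int set \<Rightarrow> int set \<Rightarrow> bool" where
  "small_on H X \<longleftrightarrow> X \<subseteq> H \<and> (\<forall>\<mu>. upper_quasi_density_on H \<mu> \<longrightarrow> \<mu> X = 0)"

(* On int, prime holds only of the positive primes, hence the absolute value. *)
definition signed_primes :: "int set" where
  "signed_primes = {p. prime \<bar>p\<bar>}"

end

theory Submission
  imports Defs "HOL-Number_Theory.Cong" "HOL-Analysis.Summation_Tests"
begin

text \<open>
  If p divides F r, then F takes prime values only finitely often on the class of r mod p. Since finite
  sets are null, sieving by finitely many primes p bounds the quasi-density by the product of the
  1 - 1/p over them. So it suffices that the sum of 1/p over the primes p for which F has a root mod p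
  diverges, and one may replace F by a monic irreducible G of degree d.

  Suppose the sum converges, and let R be the ring of integer polynomials modulo G. A maximal ideal of R
  above p has at least p residue classes, and at least \<open>p\<^sup>2\<close> if G has no root mod p; for large p there
  are at most d maximal ideals above p. Hence the reciprocals of these norms are summable. An ideal with
  N residue classes has no short nonzero elements, so by packing it contains about a 1/N share of a box
  of side M in R, uniformly in N. Take the elements t + Q b with b in such a box, where
  Q is divisible by all small primes, t is 1 modulo Q, and t is much larger than Q M. They avoid all
  maximal ideals above small primes, so by summability most of them lie in no maximal ideal at all.
  But none is a unit, because multiplication by the dominant integer t strictly enlarges coefficients.
\<close>

section \<open>Quasi-densities and the sieve\<close>

lemma upper_quasi_density_onD:
  assumes "upper_quasi_density_on H \<mu>"
  shows "X \<subseteq> H \<Longrightarrow> \<mu> X \<le> 1"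
    and "X \<subseteq> H \<Longrightarrow> Y \<subseteq> H \<Longrightarrow> \<mu> (X \<union> Y) \<le> \<mu> X + \<mu> Y"
    and "X \<subseteq> H \<Longrightarrow> k > 0 \<Longrightarrow> \<mu> ((\<lambda>x. int k * x) ` X) = \<mu> X / real k"
    and "X \<subseteq> H \<Longrightarrow> \<mu> ((\<lambda>x. x + int h) ` X) = \<mu> X"
  using assms unfolding upper_quasi_density_on_def by auto

text \<open>Subadditivity for \<open>X \<union> X = X\<close>.\<close>

lemma upper_quasi_density_on_nonneg:
  assumes "upper_quasi_density_on H \<mu>" "X \<subseteq> H"
  shows "\<mu> X \<ge> 0"
  using upper_quasi_density_onD(2)[OF assms(1) assms(2) assms(2)] by simp

lemma upper_quasi_density_on_empty:
  assumes "upper_quasi_density_on H \<mu>"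
  shows "\<mu> {} = 0"
  using upper_quasi_density_onD(3)[OF assms, of "{}" 2] by simp

lemma upper_quasi_density_on_UN:
  assumes "upper_quasi_density_on H \<mu>" "finite I" "\<And>i. i \<in> I \<Longrightarrow> A i \<subseteq> H"
  shows "\<mu> (\<Union>i\<in>I. A i) \<le> (\<Sum>i\<in>I. \<mu> (A i))"
  using assms(2,3)
proof (induction I rule: finite_induct)
  case empty
  then show ?case using upper_quasi_density_on_empty[OF assms(1)] by simp
next
  case (insert i I)
  have "\<mu> (A i \<union> (\<Union>i\<in>I. A i)) \<le> \<mu> (A i) + \<mu> (\<Union>i\<in>I. A i)"
    by (rule upper_quasi_density_onD(2)[OF assms(1)]) (use insert.prems in auto)
  also have "\<dots> \<le> \<mu> (A i) + (\<Sum>i\<in>I. \<mu> (A i))"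
    using insert by simp
  finally show ?case using insert.hyps by simp
qed

text \<open>Doubling fixes \<open>{0}\<close>, so its value is half of itself. Shifts are by
  naturals, so a negative \<open>x\<close> is moved up to 0 rather than 0 down to
  \<open>x\<close>.\<close>

lemma upper_quasi_density_on_singleton:
  assumes "upper_quasi_density_on H \<mu>" "H = UNIV \<or> H = \<nat>" "x \<in> H"
  shows "\<mu> {x} = 0"
proof -
  have zero: "0 \<in> H" using assms(2) by auto
  have 0: "\<mu> {0} = 0"
    using upper_quasi_density_onD(3)[OF assms(1), of "{0}" 2] zero by simp
  show ?thesis
  proof (cases "x \<ge> 0")
    case True
    then show ?thesis
      using upper_quasi_density_onD(4)[OF assms(1), of "{0}" "nat x"] zero 0 by simp
  next
    case False
    then show ?thesis
      using upper_quasi_density_onD(4)[OF assms(1), of "{x}" "nat (- x)"] assms(3) 0 by simp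
  qed
qed

lemma upper_quasi_density_on_finite:
  assumes "upper_quasi_density_on H \<mu>" "H = UNIV \<or> H = \<nat>" "X \<subseteq> H" "finite X"
  shows "\<mu> X = 0"
proof -
  have "\<mu> (\<Union>x\<in>X. {x}) \<le> (\<Sum>x\<in>X. \<mu> {x})"
    by (rule upper_quasi_density_on_UN[OF assms(1,4)]) (use assms(3) in auto)
  also have "\<dots> = 0"
    using assms(3) by (intro sum.neutral ballI upper_quasi_density_on_singleton[OF assms(1,2)]) auto
  finally show ?thesis using upper_quasi_density_on_nonneg[OF assms(1,3)] by simp
qed

text \<open>Quasi-densities need not be monotone, so the cover of Y by residue classes has to be exact.\<close>

lemma upper_quasi_density_on_sieve:
  assumes \<mu>: "upper_quasi_density_on H \<mu>" and H: "H = UNIV \<or> H = \<nat>"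
    and "finite T" "\<And>p. p \<in> T \<Longrightarrow> prime p"
    and "Y \<subseteq> H" "\<And>p y. p \<in> T \<Longrightarrow> y \<in> Y \<Longrightarrow> \<not> int p dvd y - r p"
  shows "\<mu> Y \<le> (\<Prod>p\<in>T. 1 - 1 / real p)"
  using assms(3-6)
proof (induction T arbitrary: Y r rule: finite_induct)
  case empty
  then show ?case using upper_quasi_density_onD(1)[OF \<mu>] by simp
next
  case (insert p T)
  have p: "prime p" "p > 0" using insert.prems(1)[of p] by (auto simp: prime_gt_0_nat)
  let ?K = "{0..<int p} - {r p mod int p}"
  \<comment> \<open>\<open>Z h\<close> collects the quotients by \<open>p\<close> of the elements of
    \<open>Y\<close> with residue \<open>h\<close>; dilation by \<open>p\<close> and a shift by
    \<open>h\<close> recover that part of \<open>Y\<close>.\<close>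
  define Z where "Z h = {y \<in> H. int p * y + h \<in> Y}" for h
  have Z_sub: "Z h \<subseteq> H" for h by (auto simp: Z_def)
  let ?A = "\<lambda>h. (\<lambda>x. x + int (nat h)) ` (\<lambda>x. int p * x) ` Z h"
  have pZ_sub: "(\<lambda>x. int p * x) ` Z h \<subseteq> H" for h
    using H Z_sub[of h] by (auto intro!: Nats_mult)
  have A_sub: "?A h \<subseteq> H" for h
    using H pZ_sub[of h] by (auto intro!: Nats_add simp del: int_nat_eq)
  have cover: "Y = (\<Union>h\<in>?K. ?A h)"
  proof
    show "Y \<subseteq> (\<Union>h\<in>?K. ?A h)"
    proof
      fix y assume y: "y \<in> Y"
      let ?h = "y mod int p"
      have h: "0 \<le> ?h" "?h < int p" using p by auto
      have "y mod int p \<noteq> r p mod int p"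
        using insert.prems(3)[of p y] y by (simp add: mod_eq_dvd_iff)
      then have hK: "?h \<in> ?K" using h by auto
      have "y div int p \<in> H"
      proof -
        have "y \<in> H" using y insert.prems(2) by auto
        moreover have "y div int p \<in> \<int>" by (metis Ints_of_int of_int_eq_id id_apply)
        ultimately show ?thesis using H p
          by (auto simp: Nats_altdef2 pos_imp_zdiv_nonneg_iff)
      qed
      then have "y div int p \<in> Z ?h" using y by (simp add: Z_def)
      then have "int p * (y div int p) + int (nat ?h) \<in> ?A ?h" by blast
      then have "y \<in> ?A ?h" using h by simp
      with hK show "y \<in> (\<Union>h\<in>?K. ?A h)" by (rule UN_I)
    qed
    show "(\<Union>h\<in>?K. ?A h) \<subseteq> Y" by (auto simp: Z_def)
  qed
  have Z_bound: "\<mu> (Z h) \<le> (\<Prod>p\<in>T. 1 - 1 / real p)" for h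
  proof -
    \<comment> \<open>As \<open>p\<close> is invertible modulo \<open>q\<close>, the class forbidden
      for \<open>p * y + h\<close> pulls back to one forbidden class for \<open>y\<close>; so the
      induction hypothesis applies to \<open>Z h\<close> with new residues.\<close>
    have "\<exists>u. \<forall>y. int q dvd y - u \<longleftrightarrow> int q dvd (int p * y + h) - r q" if "q \<in> T" for q
    proof -
      have q: "prime q" "q \<noteq> p" using insert.prems(1) insert.hyps that by auto
      then have "coprime (int p) (int q)" using p by (simp add: primes_coprime)
      then obtain v where v: "[int p * v = 1] (mod int q)"
        using cong_solve_coprime_int by blast
      have "[int p * (y - v * (r q - h)) = (int p * y + h) - r q] (mod int q)" for y
      proof -
        have "int p * (y - v * (r q - h)) - ((int p * y + h) - r q) = (1 - int p * v) * (r q - h)"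
          by (simp add: algebra_simps)
        then show ?thesis using v by (metis cong_iff_dvd_diff dvd_mult2 dvd_diff_commute)
      qed
      then have "int q dvd y - v * (r q - h) \<longleftrightarrow> int q dvd (int p * y + h) - r q" for y
        using \<open>coprime (int p) (int q)\<close>
        by (metis cong_dvd_iff cong_sym coprime_commute coprime_dvd_mult_right_iff)
      then show ?thesis by blast
    qed
    then obtain r' where r': "\<And>q y. q \<in> T \<Longrightarrow> int q dvd y - r' q \<longleftrightarrow> int q dvd (int p * y + h) - r q"
      by metis
    show ?thesis
    proof (rule insert.IH[of "Z h" r'])
      show "prime q" if "q \<in> T" for q using insert.prems(1) that by simp
      show "\<not> int q dvd y - r' q" if "q \<in> T" "y \<in> Z h" for q y
        using r'[OF that(1)] insert.prems(3)[of q "int p * y + h"] that by (auto simp: Z_def)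
    qed (rule Z_sub)
  qed
  have cardK: "real (card ?K) = real p - 1"
    using p by (subst card_Diff_singleton) (auto simp: of_nat_diff Suc_le_eq)
  have "\<mu> Y = \<mu> (\<Union>h\<in>?K. ?A h)" using cover by simp
  also have "\<dots> \<le> (\<Sum>h\<in>?K. \<mu> (?A h))"
    by (rule upper_quasi_density_on_UN[OF \<mu>], simp, rule A_sub)
  also have "\<dots> = (\<Sum>h\<in>?K. \<mu> (Z h) / real p)"
    by (simp only: upper_quasi_density_onD(4)[OF \<mu> pZ_sub] upper_quasi_density_onD(3)[OF \<mu> Z_sub p(2)])
  also have "\<dots> \<le> (\<Sum>h\<in>?K. (\<Prod>p\<in>T. 1 - 1 / real p) / real p)"
    by (intro sum_mono divide_right_mono Z_bound) auto
  also have "\<dots> = (1 - 1 / real p) * (\<Prod>p\<in>T. 1 - 1 / real p)"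
    using cardK p by (simp add: field_simps)
  finally show ?case using insert.hyps by simp
qed

section \<open>Maximal ideals of integer polynomials\<close>

text \<open>The quotient ring R is never formed: its ideals are represented by the ideals of integer
  polynomials that contain G.\<close>

definition poly_ideal :: "int poly set \<Rightarrow> bool" where
  "poly_ideal I \<longleftrightarrow> 0 \<in> I \<and> (\<forall>a\<in>I. \<forall>b\<in>I. a + b \<in> I) \<and> (\<forall>a\<in>I. \<forall>r. r * a \<in> I)"

lemma poly_idealD:
  assumes "poly_ideal I"
  shows "0 \<in> I" "a \<in> I \<Longrightarrow> b \<in> I \<Longrightarrow> a + b \<in> I" "a \<in> I \<Longrightarrow> r * a \<in> I" "a \<in> I \<Longrightarrow> a * r \<in> I"
    "a \<in> I \<Longrightarrow> - a \<in> I" "a \<in> I \<Longrightarrow> b \<in> I \<Longrightarrow> a - b \<in> I" "a \<in> I \<Longrightarrow> smult c a \<in> I"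
    "a \<in> I \<Longrightarrow> a dvd b \<Longrightarrow> b \<in> I"
proof -
  show add: "a + b \<in> I" if "a \<in> I" "b \<in> I" for a b using that assms by (auto simp: poly_ideal_def)
  show mult: "r * a \<in> I" if "a \<in> I" for r a using that assms by (auto simp: poly_ideal_def)
  show "0 \<in> I" using assms by (auto simp: poly_ideal_def)
  show "a * r \<in> I" if "a \<in> I" for r a using mult[OF that, of r] by (simp add: mult.commute)
  show minus: "- a \<in> I" if "a \<in> I" for a using mult[OF that, of "- 1"] by simp
  show "a - b \<in> I" if "a \<in> I" "b \<in> I" for a b using add[OF that(1) minus[OF that(2)]] by simp
  show "smult c a \<in> I" if "a \<in> I" for c a using mult[OF that, of "[:c:]"] by simp
  show "b \<in> I" if "a \<in> I" "a dvd b" for a b using that mult by (metis dvdE mult.commute)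
qed

definition maximal_poly_ideal :: "int poly set \<Rightarrow> bool" where
  "maximal_poly_ideal P \<longleftrightarrow> poly_ideal P \<and> 1 \<notin> P \<and> (\<forall>J. poly_ideal J \<and> P \<subseteq> J \<and> 1 \<notin> J \<longrightarrow> J = P)"

lemma maximal_poly_idealD:
  assumes "maximal_poly_ideal P"
  shows "poly_ideal P" "1 \<notin> P" "poly_ideal J \<Longrightarrow> P \<subseteq> J \<Longrightarrow> 1 \<notin> J \<Longrightarrow> J = P"
  using assms unfolding maximal_poly_ideal_def by blast+

text \<open>Zorn's lemma: 1 stays outside the union of a chain of proper ideals.\<close>

lemma maximal_poly_ideal_exists:
  assumes "poly_ideal I" "1 \<notin> I"
  obtains P where "maximal_poly_ideal P" "I \<subseteq> P"
proof -
  let ?A = "{J. poly_ideal J \<and> I \<subseteq> J \<and> 1 \<notin> J}"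
  have "\<exists>M\<in>?A. \<forall>X\<in>?A. M \<subseteq> X \<longrightarrow> X = M"
  proof (rule subset_Zorn_nonempty)
    show "?A \<noteq> {}" using assms by auto
    fix C assume C: "C \<noteq> {}" "subset.chain ?A C"
    have CA: "X \<in> C \<Longrightarrow> X \<in> ?A" for X using C(2) by (auto simp: subset.chain_def)
    have "a + b \<in> \<Union>C" if ab: "a \<in> \<Union>C" "b \<in> \<Union>C" for a b
    proof -
      obtain X Y where XY: "X \<in> C" "a \<in> X" "Y \<in> C" "b \<in> Y" using ab by auto
      then have "X \<subseteq> Y \<or> Y \<subseteq> X" using C(2) by (auto simp: subset.chain_def)
      then show ?thesis using XY CA poly_idealD(2) by blast
    qed
    moreover have "r * a \<in> \<Union>C" if "a \<in> \<Union>C" for r a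
      using that CA poly_idealD(3) by blast
    moreover have "0 \<in> \<Union>C" using C(1) CA poly_idealD(1) by blast
    ultimately have "poly_ideal (\<Union>C)" unfolding poly_ideal_def by blast
    then show "\<Union>C \<in> ?A" using C(1) CA by blast
  qed
  then obtain M where M: "M \<in> ?A" "\<forall>X\<in>?A. M \<subseteq> X \<longrightarrow> X = M" by (elim bexE)
  have "J = M" if "poly_ideal J" "M \<subseteq> J" "1 \<notin> J" for J
    using M that by (metis (mono_tags, lifting) mem_Collect_eq subset_trans)
  then have "maximal_poly_ideal M" using M(1) by (simp add: maximal_poly_ideal_def)
  then show thesis using that M(1) by simp
qed

definition ideal_adjoin :: "int poly set \<Rightarrow> int poly \<Rightarrow> int poly set" where
  "ideal_adjoin I a = {x. \<exists>c\<in>I. \<exists>u. x = c + a * u}"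

lemma ideal_adjoin_mem:
  assumes "poly_ideal I"
  shows "c \<in> I \<Longrightarrow> c \<in> ideal_adjoin I a" "a \<in> ideal_adjoin I a"
proof -
  show "c \<in> ideal_adjoin I a" if "c \<in> I" for c
    using that unfolding ideal_adjoin_def by (auto intro!: bexI[of _ c] exI[of _ 0])
  show "a \<in> ideal_adjoin I a"
    using poly_idealD(1)[OF assms] unfolding ideal_adjoin_def by (auto intro!: bexI[of _ 0] exI[of _ 1])
qed

lemma poly_ideal_adjoin:
  assumes "poly_ideal I"
  shows "poly_ideal (ideal_adjoin I a)"
  unfolding poly_ideal_def ideal_adjoin_def
proof (intro conjI ballI allI)
  show "0 \<in> {x. \<exists>c\<in>I. \<exists>u. x = c + a * u}"
    using poly_idealD(1)[OF assms] by (auto intro!: bexI[of _ 0] exI[of _ 0])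
next
  fix x y assume "x \<in> {x. \<exists>c\<in>I. \<exists>u. x = c + a * u}" "y \<in> {x. \<exists>c\<in>I. \<exists>u. x = c + a * u}"
  then obtain c u d v where "c \<in> I" "d \<in> I" "x = c + a * u" "y = d + a * v" by blast
  then have "c + d \<in> I" "x + y = (c + d) + a * (u + v)"
    using poly_idealD(2)[OF assms] by (auto simp: algebra_simps)
  then show "x + y \<in> {x. \<exists>c\<in>I. \<exists>u. x = c + a * u}" by blast
next
  fix x r assume "x \<in> {x. \<exists>c\<in>I. \<exists>u. x = c + a * u}"
  then obtain c u where "c \<in> I" "x = c + a * u" by blast
  then have "r * c \<in> I" "r * x = r * c + a * (r * u)"
    using poly_idealD(3)[OF assms] by (auto simp: algebra_simps)
  then show "r * x \<in> {x. \<exists>c\<in>I. \<exists>u. x = c + a * u}" by blast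
qed

text \<open>Adjoining \<open>a\<close> to \<open>P\<close> gives everything; \<open>u\<close> is an
  inverse of \<open>a\<close> in the residue field.\<close>

lemma maximal_poly_idealE:
  assumes "maximal_poly_ideal P" "a \<notin> P"
  obtains c u where "c \<in> P" "1 = c + a * u"
proof -
  note P = maximal_poly_idealD[OF assms(1)]
  note mem = ideal_adjoin_mem[OF P(1)]
  have "ideal_adjoin P a \<noteq> P" using mem(2) assms(2) by blast
  then have "1 \<in> ideal_adjoin P a"
    using P(3)[OF poly_ideal_adjoin[OF P(1)]] mem(1) by blast
  then show thesis using that unfolding ideal_adjoin_def by blast
qed

text \<open>Take a prime divisor \<open>p\<close> of the least positive integer \<open>m\<close> in
  \<open>P\<close>. If \<open>p\<close> were outside \<open>P\<close>, inverting it modulo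
  \<open>P\<close> would put the smaller integer \<open>m / p\<close> into \<open>P\<close>.\<close>

lemma maximal_poly_ideal_contains_prime:
  assumes P: "maximal_poly_ideal P" and n: "[:n:] \<in> P" "n \<noteq> 0"
  obtains p :: nat where "prime p" "[:int p:] \<in> P"
proof -
  note id = maximal_poly_idealD(1)[OF P] and one = maximal_poly_idealD(2)[OF P]
  have "[:\<bar>n\<bar>:] \<in> P" using n poly_idealD(5)[OF id n(1)] by (auto simp: abs_if)
  then have ex: "\<exists>m::nat. m > 0 \<and> [:int m:] \<in> P"
    using n(2) by (intro exI[of _ "nat \<bar>n\<bar>"]) auto
  define m where "m = (LEAST m::nat. m > 0 \<and> [:int m:] \<in> P)"
  have m: "m > 0" "[:int m:] \<in> P" using LeastI_ex[OF ex] by (auto simp: m_def)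
  have min: "m \<le> k" if "k > 0" "[:int k:] \<in> P" for k
    using that unfolding m_def by (intro Least_le) auto
  have "m \<noteq> 1" using m(2) one by (auto simp: one_pCons)
  then obtain p where p: "prime p" "p dvd m" using prime_factor_nat by blast
  then obtain q where q: "m = p * q" by auto
  have "[:int p:] \<in> P"
  proof (rule ccontr)
    assume "[:int p:] \<notin> P"
    then obtain c u where cu: "c \<in> P" "1 = c + [:int p:] * u" by (rule maximal_poly_idealE[OF P])
    have "[:int q:] = [:int q:] * (c + [:int p:] * u)" using cu(2) by simp
    also have "\<dots> = [:int q:] * c + [:int m:] * u" by (simp add: q algebra_simps)
    also have "\<dots> \<in> P" using cu(1) m(2) poly_idealD[OF id] by blast
    finally have "m \<le> q" using m(1) q by (intro min) auto
    then show False using q m(1) prime_gt_1_nat[OF p(1)] by simp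
  qed
  then show thesis using that p(1) by blast
qed

lemma poly_ideal_contains_prime_dvd:
  assumes "poly_ideal P" "1 \<notin> P" "prime p" "[:int p:] \<in> P" "[:n:] \<in> P"
  shows "int p dvd n"
proof (rule ccontr)
  assume "\<not> int p dvd n"
  then have "coprime n (int p)" using assms(3)
    by (metis coprime_commute prime_imp_coprime prime_nat_int_transfer)
  then obtain u v where "u * n + v * int p = 1" by (metis bezout_int coprime_imp_gcd_eq_1)
  then have "[:u:] * [:n:] + [:v:] * [:int p:] = 1" by (simp add: one_pCons mult.commute)
  then show False using assms poly_idealD[OF assms(1)] by metis
qed

text \<open>Chinese remaindering: maximality gives for each \<open>P\<close> in \<open>M\<close> an
  element of \<open>P\<close> that is 1 modulo \<open>Q\<close>, and \<open>e\<close> is the product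
  of these.\<close>

lemma maximal_poly_ideal_idempotents:
  assumes "finite M" "\<And>P. P \<in> M \<Longrightarrow> maximal_poly_ideal P" "maximal_poly_ideal Q" "Q \<notin> M"
  shows "\<exists>e. 1 - e \<in> Q \<and> (\<forall>P\<in>M. e \<in> P)"
  using assms
proof (induction M rule: finite_induct)
  case empty
  then show ?case by (auto simp: maximal_poly_ideal_def poly_ideal_def intro!: exI[of _ 1])
next
  case (insert P M)
  then obtain e where e: "1 - e \<in> Q" "\<And>P. P \<in> M \<Longrightarrow> e \<in> P" by auto
  have "maximal_poly_ideal P" using insert.prems(1) by simp
  note P = maximal_poly_idealD[OF this] and Q = maximal_poly_idealD[OF insert.prems(2)]
  have M: "poly_ideal P'" if "P' \<in> M" for P'
    using that insert.prems(1) maximal_poly_idealD(1) by blast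
  have "\<not> P \<subseteq> Q" using P(3)[of Q] Q(1,2) insert.prems(3) by auto
  then obtain a where a: "a \<in> P" "a \<notin> Q" by blast
  obtain c u where cu: "c \<in> Q" "1 = c + a * u" by (rule maximal_poly_idealE[OF insert.prems(2) a(2)])
  have "c = 1 - a * u" using cu(2) by simp
  have "1 - e * (a * u) = (1 - e) + e * c"
    unfolding \<open>c = 1 - a * u\<close> by (simp add: algebra_simps)
  also have "\<dots> \<in> Q" using e(1) cu(1) poly_idealD(2,3)[OF Q(1)] by simp
  finally have "1 - e * (a * u) \<in> Q" .
  moreover have "e * (a * u) \<in> P'" if "P' \<in> insert P M" for P'
    using that a(1) e(2) poly_idealD(3,4)[OF P(1)] poly_idealD(4)[OF M] by blast
  ultimately show ?case by blast
qed

section \<open>Lattice points modulo a monic prime polynomial\<close>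

text \<open>The points are reduced polynomials, the unique representatives modulo a monic polynomial
  of degree \<open>d\<close>. Half-open boxes serve for exact counting, symmetric ones for measuring
  size.\<close>

definition nonneg_box :: "nat \<Rightarrow> nat \<Rightarrow> int poly set" where
  "nonneg_box d M = {A. (\<forall>i. 0 \<le> coeff A i) \<and> (\<forall>i<d. coeff A i < int M) \<and> (\<forall>i\<ge>d. coeff A i = 0)}"

definition symm_box :: "nat \<Rightarrow> nat \<Rightarrow> int poly set" where
  "symm_box d L = {A. (\<forall>i. \<bar>coeff A i\<bar> \<le> int L) \<and> (\<forall>i\<ge>d. coeff A i = 0)}"

lemma nonneg_box_Suc:
  "nonneg_box (Suc d) M = (\<lambda>(c, A). pCons c A) ` ({0..<int M} \<times> nonneg_box d M)" (is "?L = ?R")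
proof
  show "?R \<subseteq> ?L"
    by (auto simp: nonneg_box_def coeff_pCons split: nat.splits)
  show "?L \<subseteq> ?R"
  proof
    fix B assume B: "B \<in> ?L"
    obtain c A where cA: "B = pCons c A" by (rule pCons_cases)
    have "coeff A i = coeff B (Suc i)" "c = coeff B 0" for i by (auto simp: cA)
    then have "c \<in> {0..<int M}" "A \<in> nonneg_box d M"
      using B by (auto simp: nonneg_box_def)
    then show "B \<in> ?R" using cA by auto
  qed
qed

lemma card_nonneg_box: "finite (nonneg_box d M) \<and> card (nonneg_box d M) = M ^ d"
proof (induction d)
  case 0
  have "nonneg_box 0 M = {0}" by (auto simp: nonneg_box_def poly_eq_iff)
  then show ?case by simp
next
  case (Suc d)
  have "inj_on (\<lambda>(c, A). pCons c A) ({0..<int M} \<times> nonneg_box d M)"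
    by (auto simp: inj_on_def)
  then show ?case using Suc by (simp add: nonneg_box_Suc card_image card_cartesian_product)
qed

lemma card_symm_box: "finite (symm_box d L) \<and> card (symm_box d L) \<le> (2 * L + 1) ^ d"
proof -
  \<comment> \<open>Adding the polynomial whose first \<open>d\<close> coefficients are all
    \<open>L\<close> moves the symmetric box into a nonnegative box of side
    \<open>2 * L + 1\<close>.\<close>
  define S where "S = (\<Sum>i<d. monom (int L) i)"
  have S: "coeff S i = (if i < d then int L else 0)" for i
    by (simp add: S_def coeff_sum)
  have "(\<lambda>A. A + S) ` symm_box d L \<subseteq> nonneg_box d (2 * L + 1)"
  proof
    fix B assume "B \<in> (\<lambda>A. A + S) ` symm_box d L"
    then obtain A where A: "A \<in> symm_box d L" "B = A + S" by auto
    have "- int L \<le> coeff A i \<and> coeff A i \<le> int L" for i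
      using A(1) by (auto simp: symm_box_def abs_le_iff minus_le_iff)
    moreover have "coeff A i = 0" if "i \<ge> d" for i using A(1) that by (auto simp: symm_box_def)
    ultimately show "B \<in> nonneg_box d (2 * L + 1)"
      unfolding nonneg_box_def A(2) by (auto simp: S add_increasing) (smt (verit))+
  qed
  moreover have "inj_on (\<lambda>A. A + S) (symm_box d L)" by (auto simp: inj_on_def)
  ultimately show ?thesis using card_nonneg_box[of d "2 * L + 1"]
    by (metis card_image card_mono finite_imageD finite_subset)
qed

lemma nonneg_box_subset_symm_box: "nonneg_box d M \<subseteq> symm_box d M"
proof
  fix A assume A: "A \<in> nonneg_box d M"
  have "\<bar>coeff A i\<bar> \<le> int M" for i using A by (cases "i < d") (auto simp: nonneg_box_def less_imp_le)
  then show "A \<in> symm_box d M" using A by (auto simp: nonneg_box_def symm_box_def)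
qed

lemma symm_box_mono: "L \<le> K \<Longrightarrow> symm_box d L \<subseteq> symm_box d K"
  by (auto simp: symm_box_def intro: order_trans)

lemma symm_box_add: "A \<in> symm_box d L \<Longrightarrow> B \<in> symm_box d K \<Longrightarrow> A + B \<in> symm_box d (L + K)"
  unfolding symm_box_def by (auto, smt (verit))

lemma symm_box_smult: "A \<in> symm_box d L \<Longrightarrow> smult (int c) A \<in> symm_box d (c * L)"
  by (auto simp: symm_box_def abs_mult mult_left_mono)

lemma symm_box_finite_bound:
  assumes "finite X" "\<And>A i. A \<in> X \<Longrightarrow> i \<ge> d \<Longrightarrow> coeff A i = 0"
  obtains w where "X \<subseteq> symm_box d w"
proof -
  have ex: "\<exists>w. A \<in> symm_box d w" if "A \<in> X" for A
  proof -
    have "\<bar>coeff A i\<bar> \<le> int (\<Sum>i<d. nat \<bar>coeff A i\<bar>)" for i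
    proof (cases "i < d")
      case True
      then have "nat \<bar>coeff A i\<bar> \<le> (\<Sum>i<d. nat \<bar>coeff A i\<bar>)" by (intro member_le_sum) auto
      then show ?thesis by linarith
    qed (use assms(2)[OF that] in auto)
    then show ?thesis using assms(2)[OF that] unfolding symm_box_def by blast
  qed
  then obtain w where w: "\<And>A. A \<in> X \<Longrightarrow> A \<in> symm_box d (w A)" by metis
  have "X \<subseteq> symm_box d (\<Sum>A\<in>X. w A)"
  proof
    fix A assume A: "A \<in> X"
    then have "w A \<le> (\<Sum>A\<in>X. w A)" using assms(1) by (intro member_le_sum) auto
    then show "A \<in> symm_box d (\<Sum>A\<in>X. w A)" using w[OF A] symm_box_mono by blast
  qed
  then show thesis by (rule that)
qed

lemma nonneg_box_mono: "L \<le> K \<Longrightarrow> nonneg_box d L \<subseteq> nonneg_box d K"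
  by (force simp: nonneg_box_def)

lemma nonneg_box_diff:
  assumes "A \<in> nonneg_box d (Suc L)" "B \<in> nonneg_box d (Suc L)"
  shows "A - B \<in> symm_box d L"
proof -
  have "\<bar>coeff A i - coeff B i\<bar> \<le> int L" for i
  proof (cases "i < d")
    case True
    then have "0 \<le> coeff A i" "coeff A i < int (Suc L)" "0 \<le> coeff B i" "coeff B i < int (Suc L)"
      using assms by (auto simp: nonneg_box_def)
    then show ?thesis by linarith
  qed (use assms in \<open>auto simp: nonneg_box_def\<close>)
  then show ?thesis using assms by (auto simp: nonneg_box_def symm_box_def)
qed

lemma nonneg_box_add:
  assumes "A \<in> nonneg_box d M" "B \<in> nonneg_box d (Suc L)"
  shows "A + B \<in> nonneg_box d (M + L)"
proof -
  have "coeff A i + coeff B i < int (M + L)" if "i < d" for i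
  proof -
    have "coeff A i < int M" "coeff B i < int (Suc L)"
      using assms that by (auto simp: nonneg_box_def)
    then show ?thesis by linarith
  qed
  then show ?thesis using assms by (auto simp: nonneg_box_def)
qed

lemma const_symm_box: "d > 0 \<Longrightarrow> [:int c:] \<in> symm_box d c"
  by (auto simp: symm_box_def coeff_pCons split: nat.splits)

text \<open>The tail bound will be applied to the finite set of primes that occur in a count, which
  need not be an interval.\<close>

lemma summable_tail_finite:
  fixes w :: "nat \<Rightarrow> real"
  assumes "summable w" "\<And>n. w n \<ge> 0" "e > 0"
  obtains N where "\<And>T. finite T \<Longrightarrow> T \<subseteq> {N<..} \<Longrightarrow> sum w T < e"
proof -
  obtain N where N: "\<And>m n. m \<ge> N \<Longrightarrow> norm (sum w {m..<n}) < e"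
    using assms(1,3) unfolding summable_Cauchy by blast
  have "sum w T < e" if T: "finite T" "T \<subseteq> {N<..}" for T
  proof -
    have "T \<subseteq> {N..<Suc (Max T)}" using T Max_ge[OF T(1)] by (auto simp: less_Suc_eq_le)
    then have "sum w T \<le> sum w {N..<Suc (Max T)}" using assms(2) by (intro sum_mono2) auto
    also have "\<dots> \<le> norm (sum w {N..<Suc (Max T)})" by simp
    also have "\<dots> < e" by (rule N) simp
    finally show ?thesis .
  qed
  then show thesis by (rule that)
qed

section \<open>The quotient ring modulo a monic prime polynomial\<close>

text \<open>Monicity allows division with remainder over the integers; primality makes the quotient
  an integral domain, so nonzero factors cancel.\<close>

locale monic_prime_poly =
  fixes G :: "int poly"
  assumes monic: "lead_coeff G = 1" and prime: "prime_elem G"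
begin

abbreviation d :: nat where "d \<equiv> degree G"

lemma degree_pos: "d > 0"
proof (rule ccontr)
  assume "\<not> d > 0"
  then have "G = 1" using monic by (metis degree_0_id gr_zeroI lead_coeff_pCons(2) one_pCons degree_eq_zeroE pCons_0_0 coeff_pCons_0)
  then show False using prime by simp
qed

lemma G_nz: "G \<noteq> 0"
  using degree_pos by auto

lemma dvd_reduced_eq_0:
  assumes "G dvd A" "\<And>i. i \<ge> d \<Longrightarrow> coeff A i = 0"
  shows "A = 0"
proof (rule ccontr)
  assume "A \<noteq> 0"
  with assms(1) have "d \<le> degree A" by (rule dvd_imp_degree_le)
  then show False using assms(2)[of "degree A"] \<open>A \<noteq> 0\<close> by simp
qed

lemma symm_box_cong_eq:
  assumes "A \<in> symm_box d L" "B \<in> symm_box d K" "G dvd A - B"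
  shows "A = B"
  using dvd_reduced_eq_0[OF assms(3)] assms(1,2) by (auto simp: symm_box_def)

lemma reduce_exists: "\<exists>B. G dvd A - B \<and> (\<forall>i\<ge>d. coeff B i = 0)"
proof -
  obtain q r where qr: "pseudo_divmod A G = (q, r)" by force
  then have "A = G * q + r" "r = 0 \<or> degree r < d"
    using pseudo_divmod[OF G_nz qr] monic by auto
  then show ?thesis by (intro exI[of _ r]) (auto simp: coeff_eq_0)
qed

text \<open>The product expands into \<open>d * d\<close> terms in monomials of degree below
  \<open>2 * d\<close>, whose reductions are all bounded by one \<open>w\<close>. The extra 1 in
  \<open>d * d * w + 1\<close> keeps the constant positive.\<close>

lemma mult_bound:
  "\<exists>C>0. \<forall>L K A B. A \<in> symm_box d L \<longrightarrow> B \<in> symm_box d K \<longrightarrow> 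
     (\<exists>D. D \<in> symm_box d (C * L * K) \<and> G dvd A * B - D)"
proof -
  have "\<forall>k. \<exists>B. G dvd monom 1 k - B \<and> (\<forall>i\<ge>d. coeff B i = 0)" using reduce_exists by blast
  then obtain R where R: "\<And>k. G dvd monom 1 k - R k" "\<And>k i. i \<ge> d \<Longrightarrow> coeff (R k) i = 0"
    by metis
  obtain w where w: "R ` {..<2 * d} \<subseteq> symm_box d w"
    by (rule symm_box_finite_bound[of "R ` {..<2 * d}" d]) (use R(2) in auto)
  have "\<exists>D. D \<in> symm_box d ((d * d * w + 1) * L * K) \<and> G dvd A * B - D"
    if A: "A \<in> symm_box d L" and B: "B \<in> symm_box d K" for L K A B
  proof -
    have expand: "P = (\<Sum>i<d. monom (coeff P i) i)" if "P \<in> symm_box d l" for P l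
      using that by (intro poly_eqI) (auto simp: coeff_sum symm_box_def)
    define D where "D = (\<Sum>i<d. \<Sum>j<d. smult (coeff A i * coeff B j) (R (i + j)))"
    have "A * B = (\<Sum>i<d. \<Sum>j<d. monom (coeff A i) i * monom (coeff B j) j)"
      by (subst expand[OF A], subst expand[OF B]) (simp add: sum_product)
    also have "\<dots> = (\<Sum>i<d. \<Sum>j<d. smult (coeff A i * coeff B j) (monom 1 (i + j)))"
      by (simp add: mult_monom smult_monom)
    finally have "A * B - D = (\<Sum>i<d. \<Sum>j<d. smult (coeff A i * coeff B j) (monom 1 (i + j) - R (i + j)))"
      by (simp add: D_def sum_subtractf smult_diff_right)
    also have "G dvd \<dots>" by (intro dvd_sum dvd_smult R(1))
    finally have "G dvd A * B - D" .
    moreover have "D \<in> symm_box d ((d * d * w + 1) * L * K)"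
    proof -
      have "\<bar>coeff D k\<bar> \<le> int ((d * d * w + 1) * L * K)" for k
      proof -
        have "\<bar>coeff D k\<bar> \<le> (\<Sum>i<d. \<Sum>j<d. \<bar>coeff A i * coeff B j * coeff (R (i + j)) k\<bar>)"
          unfolding D_def by (auto simp: coeff_sum intro!: order_trans[OF sum_abs] sum_mono)
        also have "\<dots> \<le> (\<Sum>i<d. \<Sum>j<d. int L * int K * int w)"
        proof (intro sum_mono)
          fix i j assume "i \<in> {..<d}" "j \<in> {..<d}"
          then have "i + j < 2 * d" by auto
          then have "R (i + j) \<in> symm_box d w" using w by auto
          then show "\<bar>coeff A i * coeff B j * coeff (R (i + j)) k\<bar> \<le> int L * int K * int w"
            using A B unfolding abs_mult by (intro mult_mono) (auto simp: symm_box_def)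
        qed
        also have "\<dots> = int (d * d * w * L * K)" by simp
        also have "\<dots> \<le> int ((d * d * w + 1) * L * K)"
          by (simp add: algebra_simps)
        finally show ?thesis .
      qed
      moreover have "coeff D k = 0" if "k \<ge> d" for k
        using R(2)[OF that] by (simp add: D_def coeff_sum)
      ultimately show ?thesis by (simp add: symm_box_def)
    qed
    ultimately show ?thesis by blast
  qed
  then show ?thesis by (intro exI[of _ "d * d * w + 1"]) auto
qed

definition C :: nat where
  "C = (SOME C. C > 0 \<and> (\<forall>L K A B. A \<in> symm_box d L \<longrightarrow> B \<in> symm_box d K \<longrightarrow> 
     (\<exists>D. D \<in> symm_box d (C * L * K) \<and> G dvd A * B - D)))"

lemma C_pos: "C > 0"
  and C_mult: "A \<in> symm_box d L \<Longrightarrow> B \<in> symm_box d K \<Longrightarrow>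
     \<exists>D. D \<in> symm_box d (C * L * K) \<and> G dvd A * B - D"
  using someI_ex[OF mult_bound] unfolding C_def by blast+

section \<open>Index of ideals and packing\<close>

text \<open>Such sets stand in for residue classes, so an index can be bounded without forming a
  quotient or assuming it finite.\<close>

definition incongruent :: "int poly set \<Rightarrow> int poly set \<Rightarrow> bool" where
  "incongruent I X \<longleftrightarrow> (\<forall>x\<in>X. \<forall>y\<in>X. x - y \<in> I \<longrightarrow> x = y)"

text \<open>
  The map sending (x, y) to x + b y modulo G is injective on X times a box of side K; its image lies in
  a box whose side is about 2 C L K.
\<close>

lemma index_bound:
  assumes I: "poly_ideal I" "G \<in> I" and b: "b \<in> I" "b \<in> symm_box d L" "b \<noteq> 0"
    and X: "finite X" "incongruent I X"
  shows "card X \<le> (3 * C * L) ^ d"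
proof -
  obtain r where r: "\<And>A. G dvd A - r A" "\<And>A i. i \<ge> d \<Longrightarrow> coeff (r A) i = 0"
    using reduce_exists by metis
  obtain w where w: "r ` X \<subseteq> symm_box d w"
    by (rule symm_box_finite_bound[of "r ` X" d]) (use r(2) X(1) in auto)
  \<comment> \<open>With this side the bound \<open>2 * (w + C * L * K) + 1\<close> equals
    \<open>K * (2 * C * L + 1)\<close>, so the uncontrolled size \<open>w\<close> of the reductions
    of \<open>X\<close> cancels.\<close>
  define K where "K = 2 * w + 1"
  have "\<forall>y\<in>nonneg_box d K. \<exists>D. D \<in> symm_box d (C * L * K) \<and> G dvd b * y - D"
    using C_mult[OF b(2)] nonneg_box_subset_symm_box by blast
  then obtain D where D: "\<And>y. y \<in> nonneg_box d K \<Longrightarrow> D y \<in> symm_box d (C * L * K)"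
    "\<And>y. y \<in> nonneg_box d K \<Longrightarrow> G dvd b * y - D y" by metis
  let ?f = "\<lambda>(x, y). r x + D y"
  have inj: "inj_on ?f (X \<times> nonneg_box d K)"
  proof (rule inj_onI, clarify)
    fix x y x' y' assume x: "x \<in> X" "x' \<in> X" and y: "y \<in> nonneg_box d K" "y' \<in> nonneg_box d K"
      and eq: "r x + D y = r x' + D y'"
    have "(x - x') + b * (y - y') = 
        ((x - r x) - (x' - r x')) + ((b * y - D y) - (b * y' - D y')) + ((r x + D y) - (r x' + D y'))"
      by (simp add: algebra_simps)
    also have "(r x + D y) - (r x' + D y') = 0" using eq by simp
    finally have *: "G dvd (x - x') + b * (y - y')"
      using r(1) D(2) y by (simp only: dvd_add dvd_diff add_0_right)
    \<comment> \<open>As \<open>b\<close> lies in \<open>I\<close>, this gives \<open>x = x'\<close>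
      first; primality of \<open>G\<close> then cancels the factor \<open>b\<close>.\<close>
    then have "(x - x') + b * (y - y') \<in> I" using I poly_idealD(8) by blast
    then have "(x - x') + b * (y - y') - b * (y - y') \<in> I"
      using b(1) poly_idealD(4,6)[OF I(1)] by blast
    then have "x - x' \<in> I" by simp
    then have xx: "x = x'" using X(2) x by (auto simp: incongruent_def)
    then have "G dvd b * (y - y')" using * by simp
    then have "G dvd b \<or> G dvd y - y'" using prime prime_elem_dvd_mult_iff by blast
    moreover have "\<not> G dvd b"
      using dvd_reduced_eq_0[of b] b(2,3) by (auto simp: symm_box_def)
    ultimately have "y = y'"
      using symm_box_cong_eq y nonneg_box_subset_symm_box by blast
    then show "x = x' \<and> y = y'" using xx by blast
  qed
  have "?f ` (X \<times> nonneg_box d K) \<subseteq> symm_box d (w + C * L * K)"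
    using symm_box_add w D(1) by auto
  then have "card (X \<times> nonneg_box d K) \<le> card (symm_box d (w + C * L * K))"
    using inj card_symm_box by (metis card_image card_mono)
  also have "\<dots> \<le> (2 * (w + C * L * K) + 1) ^ d" using card_symm_box by blast
  also have "2 * (w + C * L * K) + 1 = K * (2 * C * L + 1)"
    by (simp add: K_def algebra_simps)
  also have "(K * (2 * C * L + 1)) ^ d = (2 * C * L + 1) ^ d * K ^ d"
    by (simp only: power_mult_distrib mult.commute)
  finally have "card X * K ^ d \<le> (2 * C * L + 1) ^ d * K ^ d"
    using card_nonneg_box[of d K] by (simp only: card_cartesian_product)
  then have "card X \<le> (2 * C * L + 1) ^ d" by (simp add: K_def)
  also have "L > 0" using b(2,3) by (cases "L = 0") (auto simp: symm_box_def poly_eq_iff)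
  then have "(2 * C * L + 1) ^ d \<le> (3 * C * L) ^ d"
    using C_pos by (intro power_mono) (auto simp: Suc_le_eq)
  finally show ?thesis .
qed

text \<open>
  With l maximal such that \<open>(3 * C * l) ^ d < card X\<close>, two points of S within distance l coincide, so
  the boxes of side l + 1 at the points of S are disjoint. If l exceeds M, then S has at most one point.
\<close>

lemma count_in_ideal:
  fixes M :: nat
  assumes I: "poly_ideal I" "G \<in> I" and X: "finite X" "X \<noteq> {}" "incongruent I X"
    and Q: "\<And>D. smult (int Q) D \<in> I \<Longrightarrow> D \<in> I" and "t > 0"
  defines "S \<equiv> {b \<in> nonneg_box d M. [:int t:] + smult (int Q) b \<in> I}"
  shows "card S * card X \<le> (6 * C * M) ^ d \<or> 
    (M ^ d < card X \<and> card S * card X \<le> (3 * C * (t + Q * M)) ^ d)"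
proof -
  have "card X > 0" using X by (simp add: card_gt_0_iff)
  have "card X \<le> (3 * C * (card X + 1)) ^ d"
  proof -
    have "1 * card X \<le> 3 * C * (card X + 1)" using C_pos by (intro mult_mono) auto
    then have "card X \<le> 3 * C * (card X + 1)" by simp
    also have "\<dots> \<le> (3 * C * (card X + 1)) ^ d" using degree_pos C_pos by (intro self_le_power) auto
    finally show ?thesis .
  qed
  then have ex: "\<exists>l. card X \<le> (3 * C * (l + 1)) ^ d" by blast
  define l where "l = (LEAST l. card X \<le> (3 * C * (l + 1)) ^ d)"
  have l: "card X \<le> (3 * C * (l + 1)) ^ d" unfolding l_def using ex by (rule LeastI_ex)
  have l': "(3 * C * l) ^ d < card X"
  proof (cases l)
    case 0
    then show ?thesis using degree_pos \<open>card X > 0\<close> by (simp add: power_0_left)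
  next
    case (Suc m)
    then have "\<not> card X \<le> (3 * C * (m + 1)) ^ d"
      unfolding l_def by (intro not_less_Least) auto
    then show ?thesis using Suc by simp
  qed
  have fin: "finite S" using card_nonneg_box[of d M] by (simp add: S_def)
  \<comment> \<open>The factor \<open>Q\<close> can be cancelled inside \<open>I\<close>, so two
    close points would differ by a nonzero element of \<open>I\<close> that is too short for
    \<open>card X\<close> classes.\<close>
  have sep: "s = s'" if s: "s \<in> S" "s' \<in> S" "s - s' \<in> symm_box d l" for s s'
  proof (rule ccontr)
    assume "s \<noteq> s'"
    have "([:int t:] + smult (int Q) s) - ([:int t:] + smult (int Q) s') \<in> I"
      using s by (intro poly_idealD(6)[OF I(1)]) (simp_all add: S_def)
    then have "smult (int Q) (s - s') \<in> I" by (simp add: smult_diff_right)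
    then have "s - s' \<in> I" by (rule Q)
    then have "card X \<le> (3 * C * l) ^ d"
      using index_bound[OF I _ s(3) _ X(1,3)] \<open>s \<noteq> s'\<close> by simp
    then show False using l' by simp
  qed
  have "inj_on (\<lambda>(s, y). s + y) (S \<times> nonneg_box d (Suc l))"
  proof (rule inj_onI, clarify)
    fix s y s' y' assume s: "s \<in> S" "s' \<in> S" and y: "y \<in> nonneg_box d (Suc l)" "y' \<in> nonneg_box d (Suc l)"
      and eq: "s + y = s' + y'"
    have "s - s' = y' - y" using eq by (simp add: algebra_simps)
    then have "s = s'" using sep[OF s] nonneg_box_diff[OF y(2,1)] by simp
    then show "s = s' \<and> y = y'" using eq by simp
  qed
  moreover have "(\<lambda>(s, y). s + y) ` (S \<times> nonneg_box d (Suc l)) \<subseteq> nonneg_box d (M + l)"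
    using nonneg_box_add by (auto simp: S_def)
  ultimately have "card (S \<times> nonneg_box d (Suc l)) \<le> card (nonneg_box d (M + l))"
    using card_nonneg_box by (metis card_image card_mono)
  then have pack: "card S * (l + 1) ^ d \<le> (M + l) ^ d"
    by (simp add: card_cartesian_product card_nonneg_box)
  show ?thesis
  proof (cases "l \<le> M")
    \<comment> \<open>Here the enlarged side \<open>M + l\<close> is at most \<open>2 * M\<close>,
      which turns \<open>3 * C\<close> into \<open>6 * C\<close>.\<close>
    case True
    have "card S * card X \<le> card S * (3 * C * (l + 1)) ^ d" using l by simp
    also have "\<dots> = (3 * C) ^ d * (card S * (l + 1) ^ d)" by (simp only: power_mult_distrib ac_simps)
    also have "\<dots> \<le> (3 * C) ^ d * (M + l) ^ d" using pack by simp
    also have "\<dots> = (3 * C * (M + l)) ^ d" by (simp only: power_mult_distrib)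
    also have "\<dots> \<le> (6 * C * M) ^ d" using True by (intro power_mono) auto
    finally show ?thesis ..
  next
    case False
    have "M ^ d \<le> (3 * C * l) ^ d"
    proof (intro power_mono)
      have "M \<le> l" using False by simp
      also have "\<dots> \<le> 3 * C * l" using C_pos by (cases C) auto
      finally show "M \<le> 3 * C * l" .
    qed auto
    then have "M ^ d < card X" using l' by simp
    moreover have "card S * card X \<le> (3 * C * (t + Q * M)) ^ d"
    proof (cases "S = {}")
      case False
      then obtain s where s: "s \<in> S" by blast
      have "s' = s" if "s' \<in> S" for s'
      proof (rule sep[OF that s])
        have "nonneg_box d M \<subseteq> nonneg_box d (Suc l)"
          using \<open>\<not> l \<le> M\<close> by (intro nonneg_box_mono) simp
        then show "s' - s \<in> symm_box d l" using that s by (intro nonneg_box_diff) (auto simp: S_def)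
      qed
      then have "S = {s}" using s by blast
      \<comment> \<open>The one remaining point yields a nonzero element of \<open>I\<close> of size
        at most \<open>t + Q * M\<close>, and this element bounds \<open>card X\<close>.\<close>
      let ?a = "[:int t:] + smult (int Q) s"
      have "?a \<in> I" using s by (simp add: S_def)
      moreover have "?a \<in> symm_box d (t + Q * M)"
        using s nonneg_box_subset_symm_box degree_pos
        by (intro symm_box_add symm_box_smult const_symm_box) (auto simp: S_def)
      moreover have "?a \<noteq> 0"
      proof -
        have "coeff s 0 \<ge> 0" using s by (simp add: S_def nonneg_box_def)
        then have "coeff ?a 0 > 0" using \<open>t > 0\<close> by (simp add: add_pos_nonneg)
        then show ?thesis by (metis coeff_0 less_irrefl)
      qed
      ultimately have "card X \<le> (3 * C * (t + Q * M)) ^ d" by (rule index_bound[OF I _ _ _ X(1,3)])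
      then show ?thesis using \<open>S = {s}\<close> by simp
    qed auto
    ultimately show ?thesis by blast
  qed
qed

section \<open>Non-units and maximal ideals\<close>

text \<open>Let \<open>y\<close> be a reduced inverse and \<open>L\<close> its largest absolute
  coefficient. At that coefficient \<open>t\<close> contributes \<open>t * L\<close>, while the rest
  of the product has size at most \<open>Q * C * M * L\<close>. For the result to be 1,
  \<open>t * L \<le> 1 + Q * C * M * L\<close> must hold, against the size of
  \<open>t\<close>.\<close>

lemma not_unit:
  assumes b: "b \<in> nonneg_box d M" and t: "t > Q * (C + 1) * M" "Q > 0" "M > 0"
  shows "\<not> G dvd ([:int t:] + smult (int Q) b) * x - 1"
proof
  assume *: "G dvd ([:int t:] + smult (int Q) b) * x - 1"
  obtain y where y: "G dvd x - y" "\<And>i. i \<ge> d \<Longrightarrow> coeff y i = 0" using reduce_exists by blast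
  let ?a = "[:int t:] + smult (int Q) b"
  have "a * y - 1 = (a * x - 1) - a * (x - y)" for a by (simp add: algebra_simps)
  from this[of ?a] have **: "G dvd ?a * y - 1" using * y(1) by (simp only: dvd_diff dvd_mult)
  define L where "L = Max ((\<lambda>i. nat \<bar>coeff y i\<bar>) ` {..<d})"
  have "nat \<bar>coeff y i\<bar> \<le> L" if "i < d" for i
    unfolding L_def using that by (intro Max_ge) auto
  then have "\<bar>coeff y i\<bar> \<le> int L" for i using y(2)[of i] by (cases "i < d") (auto simp: nat_le_iff)
  then have yL: "y \<in> symm_box d L" using y(2) by (simp add: symm_box_def)
  have "L \<in> (\<lambda>i. nat \<bar>coeff y i\<bar>) ` {..<d}"
    unfolding L_def using degree_pos by (intro Max_in) (auto simp: lessThan_empty_iff)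
  then obtain i where i: "\<bar>coeff y i\<bar> = int L" by auto
  obtain D where D: "D \<in> symm_box d (C * M * L)" "G dvd b * y - D"
    using C_mult[of b M y L] b yL nonneg_box_subset_symm_box by blast
  have "(smult (int t) y + smult (int Q) D) - 1 = (?a * y - 1) - smult (int Q) (b * y - D)"
    by (simp add: algebra_simps smult_diff_right)
  also have "G dvd \<dots>" by (rule dvd_diff[OF ** dvd_smult[OF D(2)]])
  finally have "G dvd (smult (int t) y + smult (int Q) D) - 1" .
  moreover have "1 \<in> symm_box d 1" using const_symm_box[OF degree_pos, of 1] by (simp add: one_pCons)
  moreover have "smult (int t) y + smult (int Q) D \<in> symm_box d (t * L + Q * (C * M * L))"
    by (intro symm_box_add symm_box_smult yL D(1))
  ultimately have eq: "smult (int t) y + smult (int Q) D = 1" using symm_box_cong_eq by blast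
  have "L > 0"
  proof (rule ccontr)
    assume "\<not> L > 0"
    then have "y = 0" "D = 0" using yL D(1) by (auto simp: symm_box_def poly_eq_iff)
    then show False using eq by simp
  qed
  have "int t * \<bar>coeff y i\<bar> = \<bar>coeff 1 i - int Q * coeff D i\<bar>"
  proof -
    have "coeff (smult (int t) y + smult (int Q) D) i = coeff 1 i" using eq by simp
    then have "int t * coeff y i = coeff 1 i - int Q * coeff D i" by simp
    then show ?thesis by (metis abs_mult abs_of_nat)
  qed
  also have "\<dots> \<le> \<bar>coeff 1 i\<bar> + \<bar>int Q * coeff D i\<bar>" by (rule abs_triangle_ineq4)
  also have "\<dots> \<le> 1 + int Q * int (C * M * L)"
    using D(1) by (intro add_mono) (auto simp: abs_mult symm_box_def coeff_1 intro!: mult_left_mono)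
  finally have "int (t * L) \<le> int (1 + Q * (C * M * L))" using i by simp
  then have "t * L \<le> 1 + Q * (C * M * L)" by linarith
  moreover have "(1 + Q * (C + 1) * M) * L \<le> t * L" using t by (intro mult_right_mono) auto
  moreover have "(1 + Q * (C + 1) * M) * L = L + Q * (C * M * L) + Q * M * L" by (simp add: algebra_simps)
  ultimately have "L + Q * M * L \<le> 1" by linarith
  moreover have "Q * M * L > 0" using t \<open>L > 0\<close> by simp
  ultimately show False using \<open>L > 0\<close> by linarith
qed

lemma poly_ideal_multiples: "poly_ideal {A. G dvd A}"
  by (auto simp: poly_ideal_def)

text \<open>The ideal generated by \<open>G\<close> and \<open>a\<close> is proper. By
  \<open>index_bound\<close> its short element \<open>a\<close> forces two distinct integers to be
  congruent, so it contains a nonzero integer, and a maximal ideal above it contains a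
  prime.\<close>

lemma ideal_of_nonunit:
  assumes a: "a \<in> symm_box d L" "a \<noteq> 0" "\<And>x. \<not> G dvd a * x - 1"
  obtains P p where "maximal_poly_ideal P" "G \<in> P" "a \<in> P" "prime (p::nat)" "[:int p:] \<in> P"
proof -
  let ?J = "ideal_adjoin {A. G dvd A} a"
  have J: "poly_ideal ?J" by (rule poly_ideal_adjoin[OF poly_ideal_multiples])
  have "1 \<notin> ?J"
  proof
    assume "1 \<in> ?J"
    then obtain c u where cu: "G dvd c" "1 = c + a * u" unfolding ideal_adjoin_def by blast
    then have "a * u - 1 = - c" by simp
    then show False using a(3)[of u] cu(1) by simp
  qed
  have aJ: "a \<in> ?J" by (rule ideal_adjoin_mem(2)[OF poly_ideal_multiples])
  have GJ: "G \<in> ?J" by (rule ideal_adjoin_mem(1)[OF poly_ideal_multiples]) simp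
  define X where "X = (\<lambda>i. [:int i:]) ` {..(3 * C * L) ^ d}"
  have "card X = (3 * C * L) ^ d + 1" unfolding X_def by (subst card_image) (auto simp: inj_on_def)
  then have "\<not> incongruent ?J X"
    using index_bound[OF J GJ aJ a(1,2), of X] by (auto simp: X_def)
  then obtain x y where xy: "x \<in> X" "y \<in> X" "x - y \<in> ?J" "x \<noteq> y"
    by (auto simp: incongruent_def)
  then obtain i j :: nat where "x = [:int i:]" "y = [:int j:]" by (auto simp: X_def)
  then have n: "[:int i - int j:] \<in> ?J" "int i - int j \<noteq> 0" using xy by auto
  obtain P where P: "maximal_poly_ideal P" "?J \<subseteq> P"
    by (rule maximal_poly_ideal_exists[OF J \<open>1 \<notin> ?J\<close>])
  obtain p :: nat where "prime p" "[:int p:] \<in> P"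
    by (rule maximal_poly_ideal_contains_prime[OF P(1) subsetD[OF P(2) n(1)] n(2)])
  then show thesis using that[OF P(1) subsetD[OF P(2) GJ] subsetD[OF P(2) aJ]] by simp
qed

section \<open>Residue classes and maximal ideals above a prime\<close>

lemma classes_linear:
  assumes P: "maximal_poly_ideal P" and p: "prime p" "[:int p:] \<in> P"
  shows "\<exists>X. finite X \<and> incongruent P X \<and> card X = p"
proof (intro exI conjI)
  let ?X = "(\<lambda>i. [:int i:]) ` {..<p}"
  note PD = maximal_poly_idealD[OF P]
  show "finite ?X" by simp
  show "card ?X = p" by (subst card_image) (auto simp: inj_on_def)
  show "incongruent P ?X"
    unfolding incongruent_def
  proof clarify
    fix i j assume "i < p" "j < p" "[:int i:] - [:int j:] \<in> P"
    then have "[:int i - int j:] \<in> P" by simp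
    then have "int p dvd int i - int j" using poly_ideal_contains_prime_dvd[OF PD(1,2) p] by blast
    then have "[int i = int j] (mod int p)" by (simp add: cong_iff_dvd_diff)
    then have "[i = j] (mod p)" by (simp add: cong_int_iff)
    then show "[:int i:] = [:int j:]" using \<open>i < p\<close> \<open>j < p\<close> by (simp add: cong_less_modulus_unique_nat)
  qed
qed

text \<open>The representatives are the polynomials \<open>i + j x\<close>. If two with different
  \<open>j\<close> were congruent, x would be congruent to an integer \<open>k\<close> modulo
  \<open>P\<close>; then \<open>poly G k\<close> would lie in \<open>P\<close> and be divisible by
  \<open>p\<close>.\<close>

lemma classes_quadratic:
  assumes P: "maximal_poly_ideal P" "G \<in> P" and p: "prime p" "[:int p:] \<in> P"
    and noroot: "\<And>k. \<not> int p dvd poly G k"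
  shows "\<exists>X. finite X \<and> incongruent P X \<and> card X = p\<^sup>2"
proof (intro exI conjI)
  let ?f = "\<lambda>(i, j). [:int i, int j:]"
  let ?X = "?f ` ({..<p} \<times> {..<p})"
  note PD = maximal_poly_idealD[OF P(1)]
  note PI = poly_idealD[OF PD(1)]
  note Pp = poly_ideal_contains_prime_dvd[OF PD(1,2) p]
  have uniq: "i = j" if "i < p" "j < p" "int p dvd int i - int j" for i j
  proof -
    have "[int i = int j] (mod int p)" using that by (simp add: cong_iff_dvd_diff)
    then have "[i = j] (mod p)" by (simp add: cong_int_iff)
    then show ?thesis using that by (simp add: cong_less_modulus_unique_nat)
  qed
  show "finite ?X" by simp
  show "card ?X = p\<^sup>2"
    by (subst card_image) (auto simp: inj_on_def card_cartesian_product power2_eq_square)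
  show "incongruent P ?X"
    unfolding incongruent_def
  proof clarify
    fix i j i' j' assume lt: "i < p" "j < p" "i' < p" "j' < p"
      and mem: "[:int i, int j:] - [:int i', int j':] \<in> P"
    let ?i = "int i - int i'" and ?j = "int j - int j'"
    have mem': "[:?i, ?j:] \<in> P" using mem by simp
    have "int p dvd ?j"
    proof (rule ccontr)
      assume "\<not> int p dvd ?j"
      then have "coprime ?j (int p)" using p(1)
        by (metis coprime_commute prime_imp_coprime prime_nat_int_transfer)
      then obtain u v where uv: "u * ?j + v * int p = 1" by (metis bezout_int coprime_imp_gcd_eq_1)
      \<comment> \<open>Scaling by the inverse \<open>u\<close> of the slope modulo \<open>p\<close>
        and adding a multiple of \<open>p x\<close> makes the slope 1.\<close>
      have "[:u:] * [:?i, ?j:] + [:0, v:] * [:int p:] \<in> P" using mem' p(2) PI(2,3) by blast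
      also have "[:u:] * [:?i, ?j:] + [:0, v:] * [:int p:] = [:u * ?i, 1:]"
        using uv by (simp add: mult.commute)
      finally have lin: "[:u * ?i, 1:] \<in> P" .
      define k where "k = - (u * ?i)"
      have "poly (G - [:poly G k:]) k = 0" by simp
      then have "[:- k, 1:] dvd G - [:poly G k:]" by (simp only: poly_eq_0_iff_dvd)
      then have "G - [:poly G k:] \<in> P" using lin PI(8) by (simp add: k_def)
      then have "G - (G - [:poly G k:]) \<in> P" using P(2) PI(6) by blast
      then have "[:poly G k:] \<in> P" by simp
      then show False using Pp noroot by blast
    qed
    then have "j = j'" using uniq lt by blast
    then have "[:?i:] \<in> P" using mem' by simp
    then have "i = i'" using Pp uniq lt by blast
    then show "[:int i, int j:] = [:int i', int j':]" using \<open>j = j'\<close> by simp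
  qed
qed

text \<open>
  The combinations of the Chinese remainder idempotents with coefficients below p are pairwise
  incongruent modulo p and G, hence \<open>p ^ card M \<le> (3 * C * p) ^ d\<close>.
\<close>

lemma card_maximal_ideals:
  assumes M: "finite M" "\<And>P. P \<in> M \<Longrightarrow> maximal_poly_ideal P" "\<And>P. P \<in> M \<Longrightarrow> G \<in> P"
    and p: "prime p" "\<And>P. P \<in> M \<Longrightarrow> [:int p:] \<in> P" "p > (3 * C) ^ d"
  shows "card M \<le> d"
proof -
  have "\<exists>e. 1 - e \<in> P \<and> (\<forall>P'\<in>M - {P}. e \<in> P')" if "P \<in> M" for P
    by (rule maximal_poly_ideal_idempotents) (use that M in auto)
  then obtain e where e: "\<And>P. P \<in> M \<Longrightarrow> 1 - e P \<in> P"
    "\<And>P P'. P \<in> M \<Longrightarrow> P' \<in> M \<Longrightarrow> P' \<noteq> P \<Longrightarrow> e P \<in> P'" by (metis DiffI singletonD)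
  \<comment> \<open>The ideal generated by \<open>p\<close> and \<open>G\<close> lies in every
    \<open>P\<close> of \<open>M\<close>, and its short element \<open>p\<close> bounds its
    index.\<close>
  let ?I = "ideal_adjoin {A. G dvd A} [:int p:]"
  have I: "poly_ideal ?I" by (rule poly_ideal_adjoin[OF poly_ideal_multiples])
  have G: "G \<in> ?I" by (rule ideal_adjoin_mem(1)[OF poly_ideal_multiples]) simp
  have pI: "[:int p:] \<in> ?I" by (rule ideal_adjoin_mem(2)[OF poly_ideal_multiples])
  have sub: "x \<in> P" if x: "x \<in> ?I" and P: "P \<in> M" for x P
  proof -
    note PI = poly_idealD[OF maximal_poly_idealD(1)[OF M(2)[OF P]]]
    obtain c u where "G dvd c" "x = c + [:int p:] * u" using x unfolding ideal_adjoin_def by blast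
    then show ?thesis using M(3)[OF P] p(2)[OF P] PI(2,4,8) by blast
  qed
  define F where "F c = (\<Sum>P\<in>M. smult (int (c P)) (e P))" for c :: "int poly set \<Rightarrow> nat"
  let ?K = "PiE M (\<lambda>_. {..<p})"
  have eq: "c = c'" if c: "c \<in> ?K" "c' \<in> ?K" "F c - F c' \<in> ?I" for c c'
  proof (rule PiE_ext[OF c(1,2)])
    fix P assume P: "P \<in> M"
    note PD = maximal_poly_idealD[OF M(2)[OF P]]
    note PI = poly_idealD[OF PD(1)]
    let ?n = "int (c P) - int (c' P)"
    have sum_in: "(\<Sum>i\<in>A. f i) \<in> P" if "\<And>i. i \<in> A \<Longrightarrow> f i \<in> P" for A and f :: "int poly set \<Rightarrow> int poly"
      using that by (induction A rule: infinite_finite_induct) (auto intro: PI(1,2))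
    \<comment> \<open>Modulo \<open>P\<close> the other idempotents vanish and \<open>e P\<close> is
      1, so the difference of the coefficients at \<open>P\<close> lies in \<open>P\<close>.\<close>
    have "F c - F c' = (\<Sum>P\<in>M. smult (int (c P) - int (c' P)) (e P))"
      by (simp add: F_def sum_subtractf smult_diff_left)
    also have "\<dots> = smult ?n (e P) + (\<Sum>P\<in>M - {P}. smult (int (c P) - int (c' P)) (e P))"
      using P M(1) by (simp add: sum.remove)
    finally have 1: "F c - F c' = smult ?n (e P) + (\<Sum>P\<in>M - {P}. smult (int (c P) - int (c' P)) (e P))" .
    have 2: "(\<Sum>P\<in>M - {P}. smult (int (c P) - int (c' P)) (e P)) \<in> P"
      using e(2) P by (intro sum_in PI(7)) auto
    have "smult ?n (e P) = (F c - F c') - (\<Sum>P\<in>M - {P}. smult (int (c P) - int (c' P)) (e P))"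
      using 1 by simp
    also have "\<dots> \<in> P" using sub[OF c(3) P] 2 by (rule PI(6))
    finally have "smult ?n (e P) + smult ?n (1 - e P) \<in> P" using e(1)[OF P] PI(2,7) by blast
    then have "[:?n:] \<in> P" by (simp add: smult_diff_right one_pCons)
    then have "int p dvd ?n" using poly_ideal_contains_prime_dvd[OF PD(1,2) p(1) p(2)[OF P]] by blast
    then have "[int (c P) = int (c' P)] (mod int p)" by (simp add: cong_iff_dvd_diff)
    then have "[c P = c' P] (mod p)" by (simp add: cong_int_iff)
    moreover have "c P < p" "c' P < p" using c P by auto
    ultimately show "c P = c' P" by (simp add: cong_less_modulus_unique_nat)
  qed
  have "F c = F c' \<Longrightarrow> F c - F c' \<in> ?I" for c c' using poly_idealD(1)[OF I] by simp
  then have "inj_on F ?K" using eq by (intro inj_onI) blast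
  then have "card (F ` ?K) = p ^ card M" using M(1) by (simp add: card_image card_PiE)
  moreover have "incongruent ?I (F ` ?K)" using eq unfolding incongruent_def by blast
  moreover have "finite (F ` ?K)" using M(1) by (intro finite_imageI finite_PiE) auto
  moreover have "p > 0" using p(1) prime_gt_0_nat by blast
  ultimately have "p ^ card M \<le> (3 * C * p) ^ d"
    using index_bound[OF I G pI const_symm_box[OF degree_pos], of "F ` ?K"] by simp
  also have "\<dots> = (3 * C) ^ d * p ^ d" by (simp only: power_mult_distrib)
  \<comment> \<open>The lower bound on \<open>p\<close> absorbs the constant, at the cost of one
    more factor \<open>p\<close>.\<close>
  also have "\<dots> < p * p ^ d" using p(3) \<open>p > 0\<close> by (intro mult_strict_right_mono) auto
  finally have "p ^ card M < p ^ Suc d" by simp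
  then show ?thesis using prime_gt_1_nat[OF p(1)] by (simp add: power_strict_increasing_iff less_Suc_eq_le del: power_Suc)
qed

section \<open>Divergence over the primes modulo which G has a root\<close>

text \<open>The constants are chosen in the order \<open>Z0\<close>, \<open>Z\<close>,
  \<open>Q\<close>, \<open>\<kappa>\<close>, \<open>Z'\<close>, \<open>M\<close>, \<open>t\<close>,
  each from earlier ones. The two alternatives of \<open>count_in_ideal\<close> are each made to
  account for at most a quarter of the box.\<close>

lemma not_summable_root_primes:
  "\<not> summable (\<lambda>p. if prime p \<and> (\<exists>k. int p dvd poly G k) then 1 / real p else 0)"
proof
  let ?root = "\<lambda>p::nat. \<exists>k. int p dvd poly G k"
  assume sum: "summable (\<lambda>p. if prime p \<and> ?root p then 1 / real p else 0)"
  \<comment> \<open>\<open>N p\<close> classes are guaranteed modulo a maximal ideal above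
    \<open>p\<close>. Primes without a root enter \<open>w\<close> only as
    \<open>1 / p\<^sup>2\<close>, hence summably.\<close>
  define N where "N p = (if ?root p then p else p\<^sup>2)" for p :: nat
  define w where "w p = (if prime p then 1 / real (N p) else 0)" for p :: nat
  have w_nonneg: "w p \<ge> 0" for p by (simp add: w_def)
  have "summable (\<lambda>p. (if prime p \<and> ?root p then 1 / real p else 0) + inverse (real p ^ 2))"
    by (intro summable_add sum inverse_power_summable) simp
  then have w_sum: "summable w"
    by (rule summable_comparison_test'[where N = 0]) (auto simp: w_def N_def divide_inverse)
  \<comment> \<open>Up to \<open>d\<close> ideals lie above a large prime \<open>q\<close>, each
    taking at most \<open>(6 * C) ^ d * M ^ d * w q\<close> points in the first alternative; the 4
    leaves a quarter of the box.\<close>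
  define \<alpha> where "\<alpha> = 4 * real (d * (6 * C) ^ d)"
  have "\<alpha> > 0" using degree_pos C_pos by (simp add: \<alpha>_def)
  then obtain Z0 where Z0: "\<And>T. finite T \<Longrightarrow> T \<subseteq> {Z0<..} \<Longrightarrow> sum w T < 1 / \<alpha>"
    using summable_tail_finite[OF w_sum w_nonneg, of "1 / \<alpha>"] by auto
  \<comment> \<open>Above \<open>(3 * C) ^ d\<close> the bound of \<open>card_maximal_ideals\<close>
    applies; the factorial makes \<open>Q\<close> divisible by all primes up to
    \<open>Z\<close>.\<close>
  define Z where "Z = max Z0 ((3 * C) ^ d)"
  define Q :: nat where "Q = fact Z"
  have "Q > 0" by (simp add: Q_def)
  \<comment> \<open>For the \<open>t\<close> chosen below, \<open>\<kappa> * M ^ d\<close> bounds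
    \<open>(3 * C * (t + Q * M)) ^ d\<close>. Since \<open>\<kappa>\<close> does not involve
    \<open>M\<close>, the threshold \<open>Z'\<close> can be fixed before \<open>M\<close>.\<close>
  define \<kappa> where "\<kappa> = (3 * C * (1 + Q * (C + 1) + Q)) ^ d"
  define \<beta> where "\<beta> = 4 * real (d * \<kappa>)"
  have "\<kappa> > 0" using C_pos by (simp add: \<kappa>_def)
  then have "\<beta> > 0" using degree_pos by (simp add: \<beta>_def)
  then obtain Z' where Z': "\<And>T. finite T \<Longrightarrow> T \<subseteq> {Z'<..} \<Longrightarrow> sum w T < 1 / \<beta>"
    using summable_tail_finite[OF w_sum w_nonneg, of "1 / \<beta>"] by auto
  \<comment> \<open>In the second alternative \<open>M ^ d < N p \<le> p\<^sup>2\<close>, so this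
    choice forces \<open>p > Z'\<close>.\<close>
  define M where "M = Z'\<^sup>2 + 1"
  have "M > 0" by (simp add: M_def)
  define t where "t = 1 + Q * (C + 1) * M"
  define a where "a b = [:int t:] + smult (int Q) b" for b
  let ?B = "nonneg_box d M"
  have finB: "finite ?B" and cardB: "card ?B = M ^ d" using card_nonneg_box by auto

  have "\<exists>P p. maximal_poly_ideal P \<and> G \<in> P \<and> a b \<in> P \<and> prime (p::nat) \<and> [:int p:] \<in> P"
    if b: "b \<in> ?B" for b
  proof -
    have "a b \<in> symm_box d (t + Q * M)"
      unfolding a_def using b nonneg_box_subset_symm_box degree_pos
      by (intro symm_box_add symm_box_smult const_symm_box) auto
    moreover have "a b \<noteq> 0"
    proof -
      have "coeff b 0 \<ge> 0" using b by (simp add: nonneg_box_def)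
      then have "coeff (a b) 0 > 0" by (simp add: a_def t_def add_pos_nonneg)
      then show ?thesis by (metis coeff_0 less_irrefl)
    qed
    moreover have "\<not> G dvd a b * x - 1" for x
      unfolding a_def by (rule not_unit[OF b _ \<open>Q > 0\<close> \<open>M > 0\<close>]) (simp add: t_def)
    ultimately show ?thesis using ideal_of_nonunit by metis
  qed
  then obtain P p where Pp: "\<And>b. b \<in> ?B \<Longrightarrow> maximal_poly_ideal (P b)" "\<And>b. b \<in> ?B \<Longrightarrow> G \<in> P b"
    "\<And>b. b \<in> ?B \<Longrightarrow> a b \<in> P b" "\<And>b. b \<in> ?B \<Longrightarrow> prime (p b :: nat)" "\<And>b. b \<in> ?B \<Longrightarrow> [:int (p b):] \<in> P b"
    by metis

  \<comment> \<open>Since \<open>a b\<close> is 1 modulo \<open>Q\<close>, a prime divisor of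
    \<open>Q\<close> in \<open>P b\<close> would put 1 into \<open>P b\<close>.\<close>
  have p_ndvd: "\<not> p b dvd Q" if b: "b \<in> ?B" for b
  proof
    assume "p b dvd Q"
    then obtain q where q: "Q = p b * q" by auto
    note PD = maximal_poly_idealD[OF Pp(1)[OF b]]
    have "a b - [:int (p b):] * ([:int q:] * ([:int ((C + 1) * M):] + b)) = 1"
      by (simp add: a_def t_def q one_pCons algebra_simps smult_add_right)
    then show False
      using PD(2) Pp(3)[OF b] Pp(5)[OF b] poly_idealD(4,6)[OF PD(1)] by metis
  qed
  have p_gt: "p b > Z" if b: "b \<in> ?B" for b
  proof (rule ccontr)
    assume "\<not> p b > Z"
    then have "p b dvd Q" unfolding Q_def
      using prime_gt_0_nat[OF Pp(4)[OF b]] by (intro dvd_fact) auto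
    then show False using p_ndvd[OF b] by simp
  qed

  define r where "r I = card {b \<in> ?B. a b \<in> I}" for I
  \<comment> \<open>The bounds of both alternatives are added, so \<open>h\<close> dominates
    whichever holds; the second can occur only beyond \<open>Z'\<close>.\<close>
  define h where "h q = real ((6 * C) ^ d * M ^ d) * w q + real (\<kappa> * M ^ d) * (if q > Z' then w q else 0)" for q
  have r_bound: "real (r (P b)) \<le> h (p b)"
    if b: "b \<in> ?B" for b
  proof -
    note P = Pp(1)[OF b] and p = Pp(4)[OF b]
    note PD = maximal_poly_idealD[OF P]
    have "\<exists>X. finite X \<and> incongruent (P b) X \<and> card X = N (p b)"
    proof (cases "?root (p b)")
      case True
      then show ?thesis using classes_linear[OF P p Pp(5)[OF b]] by (simp add: N_def)
    next
      case False
      then show ?thesis using classes_quadratic[OF P Pp(2)[OF b] p Pp(5)[OF b]] by (simp add: N_def)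
    qed
    then obtain X where X: "finite X" "incongruent (P b) X" "card X = N (p b)" by blast
    have Npos: "N (p b) > 0" using prime_gt_0_nat[OF p] by (simp add: N_def)
    have w: "w (p b) = 1 / real (N (p b))" using p by (simp add: w_def)
    \<comment> \<open>\<open>Q\<close> is invertible modulo \<open>p b\<close>, hence modulo
      \<open>P b\<close>.\<close>
    have Qdvd: "D \<in> P b" if D: "smult (int Q) D \<in> P b" for D
    proof -
      have "coprime (p b) Q" using p p_ndvd[OF b] by (rule prime_imp_coprime)
      then have "coprime (int Q) (int (p b))" by (simp add: coprime_commute)
      then obtain u v where uv: "u * int Q + v * int (p b) = 1"
        by (metis bezout_int coprime_imp_gcd_eq_1)
      have "smult u (smult (int Q) D) + smult v ([:int (p b):] * D) \<in> P b"
        using D Pp(5)[OF b] poly_idealD(2,4,7)[OF PD(1)] by blast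
      also have "smult u (smult (int Q) D) + smult v ([:int (p b):] * D) = smult (u * int Q + v * int (p b)) D"
        by (simp add: smult_add_left)
      finally show ?thesis using uv by simp
    qed
    have "X \<noteq> {}" using X(3) Npos by auto
    have "t > 0" by (simp add: t_def)
    have cases: "r (P b) * N (p b) \<le> (6 * C * M) ^ d \<or>
        (M ^ d < N (p b) \<and> r (P b) * N (p b) \<le> (3 * C * (t + Q * M)) ^ d)"
      using count_in_ideal[where Q = Q and M = M, OF PD(1) Pp(2)[OF b] X(1) \<open>X \<noteq> {}\<close> X(2) Qdvd \<open>t > 0\<close>]
      unfolding X(3) r_def a_def by simp
    have conv: "real (r (P b)) \<le> real k * w (p b)" if "r (P b) * N (p b) \<le> k" for k
    proof -
      have "real (r (P b)) * real (N (p b)) \<le> real k" using that by (metis of_nat_le_iff of_nat_mult)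
      then show ?thesis using Npos unfolding w by (simp add: field_simps)
    qed
    from cases show ?thesis
    proof
      assume "r (P b) * N (p b) \<le> (6 * C * M) ^ d"
      then have "real (r (P b)) \<le> real ((6 * C) ^ d * M ^ d) * w (p b)"
        by (intro conv) (simp only: power_mult_distrib)
      then show ?thesis using w_nonneg[of "p b"] unfolding h_def by (simp add: add_increasing2)
    next
      assume *: "M ^ d < N (p b) \<and> r (P b) * N (p b) \<le> (3 * C * (t + Q * M)) ^ d"
      have "Z'\<^sup>2 < M" by (simp add: M_def)
      also have "M \<le> M ^ d" using \<open>M > 0\<close> degree_pos by (intro self_le_power) auto
      also have "M ^ d < N (p b)" using * by simp
      also have "N (p b) \<le> (p b)\<^sup>2" using prime_gt_0_nat[OF p] by (simp add: N_def power2_eq_square)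
      finally have "p b > Z'" by (rule power2_less_imp_less) simp
      have "t + Q * M \<le> (1 + Q * (C + 1) + Q) * M" using \<open>M > 0\<close> by (simp add: t_def algebra_simps)
      then have "(3 * C * (t + Q * M)) ^ d \<le> (3 * C * ((1 + Q * (C + 1) + Q) * M)) ^ d"
        by (intro power_mono mult_left_mono) auto
      also have "\<dots> = \<kappa> * M ^ d" unfolding \<kappa>_def by (simp only: power_mult_distrib mult.assoc)
      finally have "real (r (P b)) \<le> real (\<kappa> * M ^ d) * w (p b)" using * by (intro conv) simp
      then show ?thesis using \<open>p b > Z'\<close> w_nonneg[of "p b"] unfolding h_def by (simp add: add_increasing)
    qed
  qed

  \<comment> \<open>Only primes and ideals chosen for points of the box are collected, so both
    families are finite; each \<open>b\<close> is covered by its own \<open>P b\<close>.\<close>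
  define T where "T = p ` ?B"
  define V where "V q = P ` {b \<in> ?B. p b = q}" for q
  have finT: "finite T" using finB by (simp add: T_def)
  have finV: "finite (V q)" for q using finB by (simp add: V_def)
  have V_bound: "real (card (V q)) \<le> real d" if q: "q \<in> T" for q
  proof -
    have "q > (3 * C) ^ d" "prime q" using q p_gt Pp(4) by (auto simp: T_def Z_def)
    then have "card (V q) \<le> d" using Pp(1,2,5) finV
      by (intro card_maximal_ideals[where p = q]) (auto simp: V_def)
    then show ?thesis by simp
  qed
  have "?B \<subseteq> (\<Union>q\<in>T. \<Union>I\<in>V q. {b \<in> ?B. a b \<in> I})"
    using Pp(3) by (auto simp: T_def V_def)
  then have "card ?B \<le> card (\<Union>q\<in>T. \<Union>I\<in>V q. {b \<in> ?B. a b \<in> I})"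
    using finT finV finB by (intro card_mono) auto
  also have "\<dots> \<le> (\<Sum>q\<in>T. card (\<Union>I\<in>V q. {b \<in> ?B. a b \<in> I}))" by (rule card_UN_le[OF finT])
  also have "\<dots> \<le> (\<Sum>q\<in>T. \<Sum>I\<in>V q. r I)" unfolding r_def by (intro sum_mono card_UN_le finV)
  finally have "real (M ^ d) \<le> real (\<Sum>q\<in>T. \<Sum>I\<in>V q. r I)" unfolding cardB by (simp only: of_nat_le_iff)
  also have "\<dots> = (\<Sum>q\<in>T. \<Sum>I\<in>V q. real (r I))" by simp
  also have "\<dots> \<le> (\<Sum>q\<in>T. \<Sum>I\<in>V q. h q)"
    using r_bound by (intro sum_mono) (auto simp: V_def)
  also have "\<dots> = (\<Sum>q\<in>T. real (card (V q)) * h q)" by simp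
  also have "\<dots> \<le> (\<Sum>q\<in>T. real d * h q)"
    using w_nonneg V_bound by (intro sum_mono mult_right_mono) (auto simp: h_def)
  also have "\<dots> = real d * (real ((6 * C) ^ d * M ^ d) * sum w T + real (\<kappa> * M ^ d) * sum w (T \<inter> {Z'<..}))"
    unfolding sum.inter_restrict[OF finT] h_def
    by (simp only: sum.distrib sum_distrib_left[symmetric] greaterThan_iff)
  also have "\<dots> = real (M ^ d) * (\<alpha> / 4 * sum w T + \<beta> / 4 * sum w (T \<inter> {Z'<..}))"
    unfolding \<alpha>_def \<beta>_def of_nat_mult by (simp add: algebra_simps)
  also have "\<dots> \<le> real (M ^ d) * (\<alpha> / 4 * (1 / \<alpha>) + \<beta> / 4 * (1 / \<beta>))"
  proof -
    have "T \<subseteq> {Z0<..}" using p_gt by (auto simp: T_def Z_def)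
    then have "sum w T \<le> 1 / \<alpha>" using Z0 finT by (simp add: less_imp_le)
    moreover have "sum w (T \<inter> {Z'<..}) \<le> 1 / \<beta>" using Z' finT by (intro less_imp_le) auto
    ultimately show ?thesis using \<open>\<alpha> > 0\<close> \<open>\<beta> > 0\<close>
      by (intro mult_left_mono add_mono) auto
  qed
  also have "\<dots> = real (M ^ d) / 2" using \<open>\<alpha> > 0\<close> \<open>\<beta> > 0\<close> by simp
  also have "\<dots> < real (M ^ d)" using \<open>M > 0\<close> by simp
  finally show False by simp
qed

end

section \<open>Prime values of integer polynomials\<close>

lemma poly_diff_dvd: "x - y dvd poly f x - poly f (y :: int)"
proof (induction f)
  case (pCons a f)
  have "poly (pCons a f) x - poly (pCons a f) y = (x - y) * poly f x + y * (poly f x - poly f y)"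
    by (simp add: algebra_simps)
  then show ?case using pCons.IH by simp
qed simp

text \<open>For leading coefficient \<open>c\<close> and degree \<open>n\<close>, \<open>h\<close>
  is \<open>c ^ (n - 1) * f (x / c)\<close>, which is monic and still integral.\<close>

lemma monic_scaling:
  fixes f :: "int poly"
  assumes "degree f > 0"
  obtains h where "lead_coeff h = 1" "degree h = degree f"
    "\<And>k. poly h (lead_coeff f * k) = lead_coeff f ^ (degree f - 1) * poly f k"
proof -
  let ?n = "degree f" and ?c = "lead_coeff f"
  define h where "h = monom 1 ?n + (\<Sum>i<?n. monom (?c ^ (?n - 1 - i) * coeff f i) i)"
  have ch: "coeff h j = (if j = ?n then 1 else if j < ?n then ?c ^ (?n - 1 - j) * coeff f j else 0)" for j
    by (simp add: h_def coeff_sum)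
  have deg: "degree h = ?n"
    by (rule antisym[OF degree_le le_degree]) (auto simp: ch)
  have "poly h (?c * k) = ?c ^ (?n - 1) * poly f k" for k
  proof -
    have "?c ^ (?n - 1 - i) * coeff f i * (?c * k) ^ i = ?c ^ (?n - 1) * (coeff f i * k ^ i)" if "i < ?n" for i
    proof -
      have "?c ^ (?n - 1 - i) * ?c ^ i = ?c ^ (?n - 1)" using that by (simp flip: power_add)
      then show ?thesis by (simp add: power_mult_distrib algebra_simps)
    qed
    then have "(\<Sum>i<?n. ?c ^ (?n - 1 - i) * coeff f i * (?c * k) ^ i) 
        = (\<Sum>i<?n. ?c ^ (?n - 1) * (coeff f i * k ^ i))" by (intro sum.cong) auto
    moreover have "(?c * k) ^ ?n = ?c ^ (?n - 1) * (?c * k ^ ?n)"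
      using assms by (cases ?n) (simp_all add: power_mult_distrib)
    moreover have "poly f k = ?c * k ^ ?n + (\<Sum>i<?n. coeff f i * k ^ i)"
      by (simp add: poly_altdef lessThan_Suc_atMost[symmetric])
    ultimately show ?thesis
      by (simp add: h_def poly_monom poly_sum sum_distrib_left distrib_left)
  qed
  then show thesis using that[of h] deg ch by simp
qed

text \<open>A prime factor of a monic polynomial has leading coefficient 1 or -1, and multiplying by
  this sign makes it monic.\<close>

lemma monic_prime_factor:
  fixes h :: "int poly"
  assumes "lead_coeff h = 1" "degree h > 0"
  obtains G where "monic_prime_poly G" "G dvd h"
proof -
  have "\<not> is_unit h" using assms(2) by (auto simp: is_unit_poly_iff)
  moreover have "h \<noteq> 0" using assms(2) by auto
  ultimately obtain g where g: "g dvd h" "prime g" using prime_divisor_exists by blast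
  then obtain q where "h = g * q" by auto
  then have l: "lead_coeff g dvd 1" using assms(1) by (metis dvd_triv_left lead_coeff_mult)
  let ?l = "lead_coeff g"
  have l2: "?l * ?l = 1" using l by (auto simp: zdvd1_eq abs_if split: if_splits)
  have u: "is_unit [:?l:]" using l by (simp add: is_unit_const_poly_iff)
  have "prime_elem ([:?l:] * g)" using prime_elem_mult_unit_left[OF u] g(2) by blast
  moreover have "lead_coeff ([:?l:] * g) = 1" using l2 g(2) by (auto simp: lead_coeff_smult)
  moreover have "[:?l:] * g dvd h" using u g(1) by (simp only: mult_unit_dvd_iff')
  ultimately show thesis using that[of "[:?l:] * g"] by (simp only: monic_prime_poly_def simp_thms)
qed

text \<open>A root \<open>k\<close> of \<open>G\<close> modulo \<open>p\<close> is a root of the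
  scaled polynomial \<open>h\<close>. If \<open>p\<close> does not divide the leading coefficient
  \<open>c\<close> and \<open>v\<close> inverts \<open>c\<close> modulo \<open>p\<close>, then
  \<open>v * k\<close> is a root of \<open>f\<close>. The finitely many other primes do not affect
  summability.\<close>

lemma not_summable_root_primes_poly:
  fixes f :: "int poly"
  assumes "degree f > 0"
  shows "\<not> summable (\<lambda>p. if prime p \<and> (\<exists>k. int p dvd poly f k) then 1 / real p else 0)"
proof
  assume sum: "summable (\<lambda>p. if prime p \<and> (\<exists>k. int p dvd poly f k) then 1 / real p else 0)"
  let ?c = "lead_coeff f"
  have "?c \<noteq> 0" using assms by auto
  obtain h where h: "lead_coeff h = 1" "degree h = degree f"
    "\<And>k. poly h (?c * k) = ?c ^ (degree f - 1) * poly f k" using monic_scaling[OF assms] by blast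
  obtain G where G: "monic_prime_poly G" "G dvd h" using monic_prime_factor[of h] h assms by auto
  have root: "\<exists>k. int p dvd poly f k" if p: "prime p" "p > nat \<bar>?c\<bar>" and k: "int p dvd poly G k" for p k
  proof -
    have "\<not> int p dvd ?c" using p(2) \<open>?c \<noteq> 0\<close> zdvd_imp_le[of "int p" "\<bar>?c\<bar>"] by auto
    then have cop: "coprime (int p) ?c" using p(1) by (simp add: prime_imp_coprime)
    then obtain v where v: "[?c * v = 1] (mod int p)"
      using cong_solve_coprime_int by (metis coprime_commute)
    have "[?c * (v * k) = k] (mod int p)" using cong_mult[OF v cong_refl[of k]] by (simp add: mult.assoc)
    then have "int p dvd ?c * (v * k) - k" by (simp add: cong_iff_dvd_diff)
    then have "int p dvd poly h (?c * (v * k)) - poly h k" using poly_diff_dvd by (rule dvd_trans)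
    moreover have "int p dvd poly h k" using k G(2) by (auto simp: dvd_def)
    ultimately have "int p dvd (poly h (?c * (v * k)) - poly h k) + poly h k" by (rule dvd_add)
    then have "int p dvd poly h (?c * (v * k))" by simp
    then have "int p dvd ?c ^ (degree f - 1) * poly f (v * k)" using h(3) by simp
    then show ?thesis using cop by (metis coprime_dvd_mult_right_iff coprime_power_right_iff)
  qed
  have "summable (\<lambda>p. if prime p \<and> (\<exists>k. int p dvd poly G k) then 1 / real p else 0)"
    by (rule summable_comparison_test'[OF sum, of "Suc (nat \<bar>?c\<bar>)"]) (use root in auto)
  then show False using monic_prime_poly.not_summable_root_primes[OF G(1)] by blast
qed

section \<open>Smallness of the set of prime values\<close>

theorem theorem3p10:
  fixes H :: "int set" and F :: "int \<Rightarrow> int"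
  assumes "H = UNIV \<or> H = \<nat>"
    and "\<exists>f :: int poly. F = poly f"
    and "\<not> (\<exists>c. \<forall>x. F x = c)"
  shows "small_on H {k \<in> H. F k \<in> signed_primes}"
  unfolding small_on_def
proof (intro conjI allI impI)
  let ?X = "{k \<in> H. F k \<in> signed_primes}"
  show "?X \<subseteq> H" by auto
  fix \<mu> assume \<mu>: "upper_quasi_density_on H \<mu>"
  obtain f where F: "F = poly f" using assms(2) by blast
  have deg: "degree f > 0"
    using assms(3) F by (metis degree_eq_zeroE gr_zeroI poly_const_conv)
  let ?w = "\<lambda>p::nat. if prime p \<and> (\<exists>k. int p dvd poly f k) then 1 / real p else 0"
  \<comment> \<open>The sum diverges, so these bounds tend to 0.\<close>
  have bound: "\<mu> ?X \<le> exp (- sum ?w {..<n})" for n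
  proof -
    define T where "T = {p. p < n \<and> prime p \<and> (\<exists>k. int p dvd poly f k)}"
    have fin: "finite T" by (simp add: T_def)
    have "\<forall>p\<in>T. \<exists>k. int p dvd poly f k" by (auto simp: T_def)
    then obtain r where r: "\<And>p. p \<in> T \<Longrightarrow> int p dvd poly f (r p)" by metis
    \<comment> \<open>A signed prime divisible by \<open>p\<close> is \<open>p\<close> or
      \<open>- p\<close>, so \<open>E\<close> holds all exceptions to the sieve by \<open>T\<close>.
      It is finite because a non-constant polynomial takes each value finitely often.\<close>
    define E where "E = {k \<in> ?X. \<bar>F k\<bar> \<in> int ` T}"
    have "finite {k. poly (f - [:c:]) k = 0}" for c
      using deg by (intro poly_roots_finite) (metis degree_pCons_0 eq_iff_diff_eq_0 less_irrefl)
    then have "finite {k. F k = c}" for c by (simp add: F)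
    then have "finite (\<Union>p\<in>T. {k. F k = int p} \<union> {k. F k = - int p})" using fin by auto
    then have finE: "finite E" by (rule finite_subset[rotated]) (auto simp: E_def abs_if split: if_splits)
    have "\<mu> (E \<union> (?X - E)) \<le> \<mu> E + \<mu> (?X - E)"
      by (rule upper_quasi_density_onD(2)[OF \<mu>]) (auto simp: E_def)
    also have "E \<union> (?X - E) = ?X" by (auto simp: E_def)
    also have "\<mu> E = 0"
      by (rule upper_quasi_density_on_finite[OF \<mu> assms(1) _ finE]) (auto simp: E_def)
    also have "\<mu> (?X - E) \<le> (\<Prod>p\<in>T. 1 - 1 / real p)"
    proof (rule upper_quasi_density_on_sieve[OF \<mu> assms(1) fin, where r = r])
      fix p y assume p: "p \<in> T" and y: "y \<in> ?X - E"
      show "\<not> int p dvd y - r p"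
      proof
        assume "int p dvd y - r p"
        then have "int p dvd poly f y - poly f (r p)" using poly_diff_dvd dvd_trans by blast
        from dvd_add[OF this r[OF p]] have "int p dvd F y" by (simp add: F)
        moreover have "prime \<bar>F y\<bar>" using y by (simp add: signed_primes_def)
        moreover have "prime (int p)" using p by (simp add: T_def)
        ultimately have "\<bar>F y\<bar> = int p" by (metis dvd_abs_iff primes_dvd_imp_eq)
        then show False using y p by (auto simp: E_def)
      qed
    qed (auto simp: T_def)
    also have "\<dots> \<le> (\<Prod>p\<in>T. exp (- (1 / real p)))"
    proof (intro prod_mono conjI)
      fix p assume "p \<in> T"
      then have "real p \<ge> 1" using prime_gt_0_nat[of p] by (auto simp: T_def)
      then show "0 \<le> 1 - 1 / real p" by simp
      show "1 - 1 / real p \<le> exp (- (1 / real p))" using exp_ge_add_one_self[of "- (1 / real p)"] by simp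
    qed
    also have "\<dots> = exp (- (\<Sum>p\<in>T. 1 / real p))" using fin by (simp add: exp_sum sum_negf[symmetric])
    also have "(\<Sum>p\<in>T. 1 / real p) = sum ?w {..<n}"
      by (rule sum.mono_neutral_cong_left) (auto simp: T_def)
    finally show ?thesis by simp
  qed
  show "\<mu> ?X = 0"
  proof (rule ccontr)
    assume "\<mu> ?X \<noteq> 0"
    then have pos: "\<mu> ?X > 0" using upper_quasi_density_on_nonneg[OF \<mu>, of ?X] by auto
    have "sum ?w {..<n} \<le> - ln (\<mu> ?X)" for n
      using ln_mono[OF bound[of n] pos] by simp
    then have "summable ?w" by (intro summableI_nonneg_bounded) auto
    then show False using not_summable_root_primes_poly[OF deg] by blast
  qed
qed

end
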